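(* For a Finsler manifold $(M,F)$ the following hold. (a) Every $H$-Berwald space is an $H$-Landsberg space, and the converse is not true in general (there exist $H$-Landsberg spaces that are not $H$-Berwald). (b) If the condition $$C_{irjkh}\,G^r+\mathfrak{S}_{jkh}\{C_{irjk}G^r_h+C_{irj}G^r_{kh}\}=0$$ holds, then the two notions of $H$-Berwald and Berwald spaces coincide, i.e. $(M,F)$ is $H$-Berwald if and only if it is Berwald. (c) If the condition $$C_{rjkh}\,G^r+\mathfrak{S}_{jkh}\{C_{rjk}G^r_h\}=0$$ holds, then the two notions of $H$-Landsberg and Landsberg spaces coincide, i.e. $(M,F)$ is $H$-Landsberg if and only if it is Landsberg.
   Context: $M$ is an $n$-dimensional smooth manifold, $TM$ its tangent bundle, $\mathcal{T}M=TM\setminus\{0\}$ the slit tangent bundle. $(x^i)$ are local coordinates on $M$ and $(x^i,y^i)$ the induced coordinates on $TM$; $\partial_i:=\frac{\partial}{\partial x^i}$, $\dot{\partial}_i:=\frac{\partial}{\partial y^i}$; the summation convention is used. A Finsler metric is a function $F:TM\to\mathbb{R}$ with $F\ge 0$, $F(x,y)=0$ iff $y=0$, $F$ smooth on $\mathcal{T}M$, $F(x,\lambda y)=\lambda F(x,y)$ for $\lambda>0$, and such that the matrix $g_{ij}:=\frac12\dot{\partial}_i\dot{\partial}_jF^2$ is non-degenerate at each point of $\mathcal{T}M$; $(g^{ij})$ is its inverse. The geodesic spray of $F$ is $S=y^i\partial_i-2G^i\dot{\partial}_i$ with $G^i=\frac14 g^{ih}(y^r\partial_r\dot{\partial}_hF^2-\partial_hF^2)$.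 Set $G^h_i:=\dot{\partial}_iG^h$ and $G^h_{ij}:=\dot{\partial}_jG^h_i$ (Berwald connection). The Cartan tensor is $C_{ijk}:=\frac12\dot{\partial}_kg_{ij}$, and $C_{ijkh}:=\dot{\partial}_hC_{ijk}$, $C_{ijkhr}:=\dot{\partial}_rC_{ijkh}$. $\mathfrak{S}_{jkh}$ denotes the cyclic sum over the indices $j,k,h$. The $F$-covariant coefficients of $S$ are $H_i:=g_{ir}G^r=\frac14(y^r\partial_r\dot{\partial}_iF^2-\partial_iF^2)$. Put $H_{ij}:=\dot{\partial}_jH_i$, $H_{ijk}:=\dot{\partial}_kH_{ij}$, $H_{ijkh}:=\dot{\partial}_hH_{ijk}$ and $\mathcal{L}_{jkh}:=y^iH_{ijkh}$. $(M,F)$ is an $H$-Berwald space if $H_{ijkh}$ vanishes (i.e. each $H_i$ is quadratic in $y$), and an $H$-Landsberg space if $\mathcal{L}_{jkh}$ vanishes. These objects are not components of tensors; they are computed in the local coordinates under consideration. $(M,F)$ is Berwald if $\dot{\partial}_hG^r_{jk}=0$ (the $G^i$ are quadratic in $y$), and Landsberg if $y^ig_{ir}\dot{\partial}_hG^r_{jk}=0$. *)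

theory Defs
  imports "HOL-Analysis.Analysis"
begin

section \<open>Smooth maps between Euclidean spaces\<close>

text \<open>Meant for open sets \<open>S\<close>.  All directional derivatives along constant vectors of a
  \<open>C\<^sup>k\<^sup>+\<^sup>1\<close> map have to be \<open>C\<^sup>k\<close>; in finite dimension this is
  the usual notion.\<close>

primrec Ck_on :: "nat \<Rightarrow> ('a::euclidean_space \<Rightarrow> 'b::real_normed_vector) \<Rightarrow> 'a set \<Rightarrow> bool" where
  "Ck_on 0 f S \<longleftrightarrow> continuous_on S f"
| "Ck_on (Suc k) f S \<longleftrightarrow>
     (\<forall>x\<in>S. f differentiable (at x)) \<and>
     (\<forall>v. Ck_on k (\<lambda>x. frechet_derivative f (at x) v) S)"

definition smooth_on :: "'a::euclidean_space set \<Rightarrow> ('a \<Rightarrow> 'b::real_normed_vector) \<Rightarrow> bool" where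
  "smooth_on S f \<longleftrightarrow> (\<forall>k. Ck_on k f S)"


section \<open>Smooth manifolds and their tangent bundles\<close>

text \<open>A chart is a pair of its domain and its coordinate map; the values of the coordinate map
  outside the domain are irrelevant.\<close>

type_synonym ('m, 'n) chart = "'m set \<times> ('m \<Rightarrow> real ^ 'n)"

abbreviation dom_of :: "('m, 'n) chart \<Rightarrow> 'm set" where
  "dom_of c \<equiv> fst c"

abbreviation map_of_chart :: "('m, 'n) chart \<Rightarrow> 'm \<Rightarrow> real ^ 'n" where
  "map_of_chart c \<equiv> snd c"

definition is_chart :: "'m topology \<Rightarrow> ('m, 'n::finite) chart \<Rightarrow> bool" where
  "is_chart M c \<longleftrightarrow>
     openin M (dom_of c) \<and> open (map_of_chart c ` dom_of c) \<and>
     homeomorphic_map (subtopology M (dom_of c)) (top_of_set (map_of_chart c ` dom_of c))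
       (map_of_chart c)"

definition transition :: "('m, 'n) chart \<Rightarrow> ('m, 'n) chart \<Rightarrow> real ^ 'n \<Rightarrow> real ^ 'n" where
  "transition c d = map_of_chart d \<circ> inv_into (dom_of c) (map_of_chart c)"

text \<open>The atlas is not required to be maximal.  It fixes the smooth structure, and at the same
  time it is the system of local coordinates under consideration for the notions below that do
  depend on coordinates.\<close>

definition smooth_manifold :: "'m topology \<Rightarrow> ('m, 'n::finite) chart set \<Rightarrow> bool" where
  "smooth_manifold M \<A> \<longleftrightarrow>
     Hausdorff_space M \<and> second_countable M \<and>
     (\<forall>c\<in>\<A>. is_chart M c) \<and> (\<Union>c\<in>\<A>. dom_of c) = topspace M \<and>
     (\<forall>c\<in>\<A>. \<forall>d\<in>\<A>.
        smooth_on (map_of_chart c ` (dom_of c \<inter> dom_of d)) (transition c d))"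

text \<open>A tangent vector at \<open>p\<close> is given by its components in all the charts around \<open>p\<close>, which
  transform by the Jacobians of the coordinate changes.  The components in the other charts are
  set to \<open>0\<close>, so that equality of tangent vectors is equality of functions.\<close>

definition tangent_space ::
    "('m, 'n::finite) chart set \<Rightarrow> 'm \<Rightarrow> (('m, 'n) chart \<Rightarrow> real ^ 'n) set" where
  "tangent_space \<A> p = {v.
     (\<forall>c. \<not> (c \<in> \<A> \<and> p \<in> dom_of c) \<longrightarrow> v c = 0) \<and>
     (\<forall>c\<in>\<A>. \<forall>d\<in>\<A>. p \<in> dom_of c \<inter> dom_of d \<longrightarrow>
        v d = frechet_derivative (transition c d) (at (map_of_chart c p)) (v c))}"

definition tangent_bundle ::
    "('m, 'n::finite) chart set \<Rightarrow> 'm set \<Rightarrow> ('m \<times> (('m, 'n) chart \<Rightarrow> real ^ 'n)) set" where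
  "tangent_bundle \<A> U = (SIGMA p:U. tangent_space \<A> p)"

text \<open>The induced coordinates \<open>(x, y)\<close> on the tangent bundle.\<close>

definition induced_coords ::
    "('m, 'n) chart \<Rightarrow> 'm \<times> (('m, 'n) chart \<Rightarrow> real ^ 'n) \<Rightarrow> (real ^ 'n) \<times> (real ^ 'n)" where
  "induced_coords c u = (map_of_chart c (fst u), snd u c)"

definition in_coords ::
    "('m, 'n::finite) chart set \<Rightarrow> ('m, 'n) chart \<Rightarrow> ('m \<times> (('m, 'n) chart \<Rightarrow> real ^ 'n) \<Rightarrow> real)
      \<Rightarrow> (real ^ 'n) \<times> (real ^ 'n) \<Rightarrow> real" where
  "in_coords \<A> c F = F \<circ> inv_into (tangent_bundle \<A> (dom_of c)) (induced_coords c)"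

definition slit_coords :: "('m, 'n::finite) chart \<Rightarrow> ((real ^ 'n) \<times> (real ^ 'n)) set" where
  "slit_coords c = (map_of_chart c ` dom_of c) \<times> (UNIV - {0})"


section \<open>Coordinate expressions\<close>

text \<open>In this section \<open>F\<close> is a function of the coordinates \<open>z = (x, y)\<close>.\<close>

type_synonym 'n field = "(real ^ 'n) \<times> (real ^ 'n) \<Rightarrow> real"

definition dx :: "'n::finite \<Rightarrow> 'n field \<Rightarrow> 'n field" where
  "dx i f z = frechet_derivative f (at z) (axis i 1, 0)"

definition dy :: "'n::finite \<Rightarrow> 'n field \<Rightarrow> 'n field" where
  "dy i f z = frechet_derivative f (at z) (0, axis i 1)"

definition sq :: "'n field \<Rightarrow> 'n field" where
  "sq F z = (F z)\<^sup>2"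

definition metric :: "'n::finite field \<Rightarrow> 'n \<Rightarrow> 'n \<Rightarrow> 'n field" where
  "metric F i j z = 1/2 * dy i (dy j (sq F)) z"

definition metric_matrix :: "'n::finite field \<Rightarrow> (real ^ 'n) \<times> (real ^ 'n) \<Rightarrow> real ^ 'n ^ 'n" where
  "metric_matrix F z = (\<chi> i j. metric F i j z)"

definition spray :: "'n::finite field \<Rightarrow> 'n \<Rightarrow> 'n field" where
  "spray F i z = 1/4 * (\<Sum>h\<in>UNIV. matrix_inv (metric_matrix F z) $ i $ h *
     ((\<Sum>r\<in>UNIV. snd z $ r * dx r (dy h (sq F)) z) - dx h (sq F) z))"

text \<open>\<open>spray1 F h i\<close> is \<open>G\<^sup>h\<^sub>i\<close>, \<open>spray2 F h i j\<close> is \<open>G\<^sup>h\<^sub>i\<^sub>j\<close>, and \<open>spray3 F r j k h\<close> is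
  the derivative of \<open>G\<^sup>r\<^sub>j\<^sub>k\<close> with respect to \<open>y\<^sup>h\<close>.\<close>

definition spray1 :: "'n::finite field \<Rightarrow> 'n \<Rightarrow> 'n \<Rightarrow> 'n field" where
  "spray1 F h i = dy i (spray F h)"

definition spray2 :: "'n::finite field \<Rightarrow> 'n \<Rightarrow> 'n \<Rightarrow> 'n \<Rightarrow> 'n field" where
  "spray2 F h i j = dy j (spray1 F h i)"

definition spray3 :: "'n::finite field \<Rightarrow> 'n \<Rightarrow> 'n \<Rightarrow> 'n \<Rightarrow> 'n \<Rightarrow> 'n field" where
  "spray3 F r j k h = dy h (spray2 F r j k)"

definition cartan :: "'n::finite field \<Rightarrow> 'n \<Rightarrow> 'n \<Rightarrow> 'n \<Rightarrow> 'n field" where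
  "cartan F i j k z = 1/2 * dy k (metric F i j) z"

definition cartan1 :: "'n::finite field \<Rightarrow> 'n \<Rightarrow> 'n \<Rightarrow> 'n \<Rightarrow> 'n \<Rightarrow> 'n field" where
  "cartan1 F i j k h = dy h (cartan F i j k)"

definition cartan2 :: "'n::finite field \<Rightarrow> 'n \<Rightarrow> 'n \<Rightarrow> 'n \<Rightarrow> 'n \<Rightarrow> 'n \<Rightarrow> 'n field" where
  "cartan2 F i j k h r = dy r (cartan1 F i j k h)"

definition Hcov :: "'n::finite field \<Rightarrow> 'n \<Rightarrow> 'n field" where
  "Hcov F i z = (\<Sum>r\<in>UNIV. metric F i r z * spray F r z)"

definition Hcov1 :: "'n::finite field \<Rightarrow> 'n \<Rightarrow> 'n \<Rightarrow> 'n field" where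
  "Hcov1 F i j = dy j (Hcov F i)"

definition Hcov2 :: "'n::finite field \<Rightarrow> 'n \<Rightarrow> 'n \<Rightarrow> 'n \<Rightarrow> 'n field" where
  "Hcov2 F i j k = dy k (Hcov1 F i j)"

definition Hcov3 :: "'n::finite field \<Rightarrow> 'n \<Rightarrow> 'n \<Rightarrow> 'n \<Rightarrow> 'n \<Rightarrow> 'n field" where
  "Hcov3 F i j k h = dy h (Hcov2 F i j k)"

definition Lcov :: "'n::finite field \<Rightarrow> 'n \<Rightarrow> 'n \<Rightarrow> 'n \<Rightarrow> 'n field" where
  "Lcov F j k h z = (\<Sum>i\<in>UNIV. snd z $ i * Hcov3 F i j k h z)"

definition cyclic_sum :: "('n \<Rightarrow> 'n \<Rightarrow> 'n \<Rightarrow> real) \<Rightarrow> 'n \<Rightarrow> 'n \<Rightarrow> 'n \<Rightarrow> real" where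
  "cyclic_sum T j k h = T j k h + T k h j + T h j k"


section \<open>Finsler manifolds\<close>

definition finsler_manifold ::
    "'m topology \<Rightarrow> ('m, 'n::finite) chart set \<Rightarrow> ('m \<times> (('m, 'n) chart \<Rightarrow> real ^ 'n) \<Rightarrow> real)
      \<Rightarrow> bool" where
  "finsler_manifold M \<A> F \<longleftrightarrow>
     smooth_manifold M \<A> \<and>
     (\<forall>(p, v) \<in> tangent_bundle \<A> (topspace M).
        F (p, v) \<ge> 0 \<and> (F (p, v) = 0 \<longleftrightarrow> v = (\<lambda>_. 0)) \<and>
        (\<forall>t>0. F (p, \<lambda>c. t *\<^sub>R v c) = t * F (p, v))) \<and>
     (\<forall>c\<in>\<A>. smooth_on (slit_coords c) (in_coords \<A> c F) \<and>
        (\<forall>z\<in>slit_coords c. invertible (metric_matrix (in_coords \<A> c F) z)))"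

text \<open>\<open>H\<close>-Berwald and \<open>H\<close>-Landsberg refer to the charts of the given atlas; in contrast, Berwald
  and Landsberg do not depend on the choice of an atlas.\<close>

definition H_Berwald ::
    "('m, 'n::finite) chart set \<Rightarrow> ('m \<times> (('m, 'n) chart \<Rightarrow> real ^ 'n) \<Rightarrow> real) \<Rightarrow> bool" where
  "H_Berwald \<A> F \<longleftrightarrow> (\<forall>c\<in>\<A>. \<forall>z\<in>slit_coords c. \<forall>i j k h.
     Hcov3 (in_coords \<A> c F) i j k h z = 0)"

definition H_Landsberg ::
    "('m, 'n::finite) chart set \<Rightarrow> ('m \<times> (('m, 'n) chart \<Rightarrow> real ^ 'n) \<Rightarrow> real) \<Rightarrow> bool" where
  "H_Landsberg \<A> F \<longleftrightarrow> (\<forall>c\<in>\<A>. \<forall>z\<in>slit_coords c. \<forall>j k h.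
     Lcov (in_coords \<A> c F) j k h z = 0)"

definition Berwald ::
    "('m, 'n::finite) chart set \<Rightarrow> ('m \<times> (('m, 'n) chart \<Rightarrow> real ^ 'n) \<Rightarrow> real) \<Rightarrow> bool" where
  "Berwald \<A> F \<longleftrightarrow> (\<forall>c\<in>\<A>. \<forall>z\<in>slit_coords c. \<forall>r j k h.
     spray3 (in_coords \<A> c F) r j k h z = 0)"

definition Landsberg ::
    "('m, 'n::finite) chart set \<Rightarrow> ('m \<times> (('m, 'n) chart \<Rightarrow> real ^ 'n) \<Rightarrow> real) \<Rightarrow> bool" where
  "Landsberg \<A> F \<longleftrightarrow> (\<forall>c\<in>\<A>. \<forall>z\<in>slit_coords c. \<forall>j k h.
     (\<Sum>i\<in>UNIV. \<Sum>r\<in>UNIV. snd z $ i * metric (in_coords \<A> c F) i r z *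
        spray3 (in_coords \<A> c F) r j k h z) = 0)"

text \<open>The summation over \<open>r\<close> may be taken inside the cyclic sum over the other indices.\<close>

definition Berwald_condition ::
    "('m, 'n::finite) chart set \<Rightarrow> ('m \<times> (('m, 'n) chart \<Rightarrow> real ^ 'n) \<Rightarrow> real) \<Rightarrow> bool" where
  "Berwald_condition \<A> F \<longleftrightarrow> (\<forall>c\<in>\<A>. \<forall>z\<in>slit_coords c. \<forall>i j k h.
     (let f = in_coords \<A> c F in
       (\<Sum>r\<in>UNIV. cartan2 f i r j k h z * spray f r z) +
       cyclic_sum (\<lambda>j k h. \<Sum>r\<in>UNIV.
         cartan1 f i r j k z * spray1 f r h z + cartan f i r j z * spray2 f r k h z) j k h = 0))"

definition Landsberg_condition ::
    "('m, 'n::finite) chart set \<Rightarrow> ('m \<times> (('m, 'n) chart \<Rightarrow> real ^ 'n) \<Rightarrow> real) \<Rightarrow> bool" where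
  "Landsberg_condition \<A> F \<longleftrightarrow> (\<forall>c\<in>\<A>. \<forall>z\<in>slit_coords c. \<forall>j k h.
     (let f = in_coords \<A> c F in
       (\<Sum>r\<in>UNIV. cartan1 f r j k h z * spray f r z) +
       cyclic_sum (\<lambda>j k h. \<Sum>r\<in>UNIV. cartan f r j k z * spray1 f r h z) j k h = 0))"

end

theory Submission
  imports Defs
begin

text \<open>
Everything happens in one chart.  Write \<open>G\<^sup>r\<close> for the spray coefficients, \<open>H\<^sub>i = g\<^sub>i\<^sub>r G\<^sup>r\<close>, and use
that a \<open>y\<close>-derivative of \<open>g\<^sub>i\<^sub>r\<close> is twice a Cartan tensor.

Part (b) is the Leibniz rule: three \<open>y\<close>-derivatives of \<open>g\<^sub>i\<^sub>r G\<^sup>r\<close> give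
\<open>H\<^sub>i\<^sub>j\<^sub>k\<^sub>h = g\<^sub>i\<^sub>r \<partial>\<^sub>h G\<^sup>r\<^sub>j\<^sub>k + 2 B\<^sub>i\<^sub>j\<^sub>k\<^sub>h\<close>, where \<open>B\<close> is the left-hand side of the condition
(\<open>Hcov3_eq\<close>).  If \<open>B = 0\<close>, then the two sides vanish together because \<open>g\<close> is invertible.

For part (c) this is contracted with \<open>y\<^sup>i\<close>.  The Cartan tensor is symmetric and homogeneous of
degree \<open>-1\<close>, and \<open>y\<^sup>i C\<^sub>i\<^sub>r\<^sub>j = 0\<close>; hence, with \<open>X = C\<^sub>r\<^sub>j\<^sub>k\<^sub>h G\<^sup>r\<close> and \<open>Y\<close> the cyclic sum of
\<open>C\<^sub>r\<^sub>j\<^sub>k G\<^sup>r\<^sub>h\<close>, the Landsberg expressions for \<open>H\<close> and for \<open>G\<close> differ by \<open>-4X - 2Y\<close> (\<open>Lcov_eq\<close>).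
The condition reads \<open>X + Y = 0\<close>, which is not a multiple of this difference.  It nevertheless
forces \<open>X = Y = 0\<close> when it holds on the whole slit bundle (\<open>landsberg_condition_splits\<close>):
contraction with \<open>y\<^sup>h\<close> yields \<open>C\<^sub>r\<^sub>j\<^sub>k G\<^sup>r = 0\<close>, the \<open>y\<^sup>h\<close>-derivative of this equation is
\<open>C\<^sub>r\<^sub>j\<^sub>k\<^sub>h G\<^sup>r + C\<^sub>r\<^sub>j\<^sub>k G\<^sup>r\<^sub>h = 0\<close>, and its cyclic sum \<open>3X + Y = 0\<close> leaves only \<open>X = 0\<close>.

The implication in part (a) is immediate.  The separating example is \<open>F\<^sup>2 = |y|\<^sup>2 + 2 |y| (x \<bullet> y)\<close>
on a small disc in the plane.  There \<open>H\<^sub>i = |y| y\<^sub>i / 2\<close> is the \<open>y\<close>-gradient of \<open>T = |y|\<^sup>3 / 6\<close>, so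
\<open>y\<^sup>i H\<^sub>i\<^sub>j\<^sub>k\<^sub>h\<close> is the Euler operator applied to a third derivative of \<open>T\<close>, which is homogeneous of
degree \<open>0\<close>; it vanishes.  But \<open>H\<^sub>i\<close> is not quadratic: \<open>H\<^sub>1\<^sub>1\<^sub>1\<^sub>1 = 3/2\<close> at \<open>y = (0, 1)\<close>.

The analysis behind this is the closure of smooth functions under the operations that occur, the
symmetry of second derivatives, Cramer's rule for the smoothness of \<open>G\<^sup>r\<close>, and Euler's relation
for homogeneous functions.  The homogeneity of \<open>F\<close> on tangent vectors reaches the coordinate
expression because every coordinate pair belongs to exactly one tangent vector, which is where the
cocycle property of the Jacobians enters.
\<close>

section \<open>Calculus of smooth functions\<close>

definition dirder :: "'a::euclidean_space \<Rightarrow> ('a \<Rightarrow> 'b::real_normed_vector) \<Rightarrow> 'a \<Rightarrow> 'b" where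
  "dirder v f x = frechet_derivative f (at x) v"

lemma dirder_eq: "(f has_derivative f') (at x) \<Longrightarrow> dirder v f x = f' v"
  unfolding dirder_def by (metis frechet_derivative_at)

text \<open>Two functions that agree near \<open>x\<close> have the same set of derivatives at \<open>x\<close>, so the choice that
\<^const>\<open>frechet_derivative\<close> makes from this set is the same, even where the set is empty.\<close>

lemma dirder_cong:
  assumes "open S" "x \<in> S" "\<And>z. z \<in> S \<Longrightarrow> f z = g z"
  shows "dirder v f x = dirder v g x"
proof -
  have "(f has_derivative f') (at x) \<longleftrightarrow> (g has_derivative f') (at x)" for f'
    using has_derivative_transform_within_open[OF _ assms(1,2)] assms(3) by metis
  then show ?thesis
    unfolding dirder_def frechet_derivative_def by simp
qed

lemma Ck_on_Suc:
  "Ck_on (Suc k) f S \<longleftrightarrow> (\<forall>x\<in>S. f differentiable (at x)) \<and> (\<forall>v. Ck_on k (dirder v f) S)"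
  by (simp add: dirder_def[abs_def])

declare Ck_on.simps(2) [simp del]

lemma Ck_on_cong:
  assumes "open S" "\<And>z. z \<in> S \<Longrightarrow> f z = g z"
  shows "Ck_on k f S \<longleftrightarrow> Ck_on k g S"
  using assms(2)
proof (induction k arbitrary: f g)
  case 0
  then show ?case by (simp cong: continuous_on_cong)
next
  case (Suc k)
  have "f differentiable (at x) \<longleftrightarrow> g differentiable (at x)" if "x \<in> S" for x
    unfolding differentiable_def
    using has_derivative_transform_within_open[OF _ assms(1) that] Suc.prems by metis
  moreover have "Ck_on k (dirder v f) S \<longleftrightarrow> Ck_on k (dirder v g) S" for v
    by (rule Suc.IH) (rule dirder_cong[OF assms(1)], use Suc.prems in auto)
  ultimately show ?case by (simp add: Ck_on_Suc)
qed

text \<open>The usual way to climb one order of differentiability: a formula for the derivative on the open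
set \<open>S\<close> may replace \<^const>\<open>frechet_derivative\<close>.\<close>

lemma Ck_on_SucI:
  assumes "open S" "\<And>x. x \<in> S \<Longrightarrow> (f has_derivative f' x) (at x)" "\<And>v. Ck_on k (\<lambda>x. f' x v) S"
  shows "Ck_on (Suc k) f S"
proof -
  have "Ck_on k (dirder v f) S" for v
    using Ck_on_cong[OF assms(1), of "dirder v f" "\<lambda>x. f' x v"] assms(2,3) dirder_eq by metis
  then show ?thesis
    using assms(2) unfolding Ck_on_Suc differentiable_def by blast
qed

lemma Ck_on_has_derivative:
  "Ck_on (Suc k) f S \<Longrightarrow> x \<in> S \<Longrightarrow> (f has_derivative (\<lambda>v. dirder v f x)) (at x)"
  unfolding dirder_def Ck_on_Suc using frechet_derivative_works by metis

lemma Ck_on_SucD: "Ck_on (Suc k) f S \<Longrightarrow> Ck_on k f S"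
proof (induction k arbitrary: f)
  case 0
  then show ?case
    by (auto simp: Ck_on_Suc continuous_on_eq_continuous_at
        intro!: continuous_at_imp_continuous_on differentiable_imp_continuous_within)
next
  case (Suc k)
  then show ?case by (simp add: Ck_on_Suc[of "Suc k"] Ck_on_Suc[of k])
qed

lemma Ck_on_dirder: "Ck_on (Suc k) f S \<Longrightarrow> Ck_on k (dirder v f) S"
  by (simp add: Ck_on_Suc)

lemma Ck_on_const: "Ck_on k (\<lambda>x. c) S"
  by (induction k arbitrary: c) (simp_all add: Ck_on_Suc dirder_def[abs_def])

lemma Ck_on_bounded_linear:
  assumes "bounded_linear f" "open S"
  shows "Ck_on k f S"
proof (cases k)
  case 0
  then show ?thesis using assms(1) by (simp add: linear_continuous_on)
next
  case (Suc l)
  then show ?thesis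
    using Ck_on_SucI[OF assms(2) bounded_linear.has_derivative[OF assms(1) has_derivative_ident]]
      Ck_on_const by auto
qed

lemma Ck_on_add:
  assumes "open S" "Ck_on k f S" "Ck_on k g S"
  shows "Ck_on k (\<lambda>x. f x + g x) S"
  using assms(2,3)
proof (induction k arbitrary: f g)
  case 0
  then show ?case by (simp add: continuous_intros)
next
  case (Suc k)
  show ?case
    by (rule Ck_on_SucI[OF assms(1)], rule has_derivative_add)
      (use Suc in \<open>auto intro: Ck_on_has_derivative Ck_on_dirder\<close>)
qed

text \<open>The derivative formulas for products, inverses and roots contain only the original functions, their
derivatives and (for inverses and roots) the result itself at one order less.  Each closure
property is therefore an induction on the order that uses the previous ones.\<close>

lemma Ck_on_mult:
  fixes f g :: "'a::euclidean_space \<Rightarrow> real"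
  assumes "open S" "Ck_on k f S" "Ck_on k g S"
  shows "Ck_on k (\<lambda>x. f x * g x) S"
  using assms(2,3)
proof (induction k arbitrary: f g)
  case 0
  then show ?case by (simp add: continuous_intros)
next
  case (Suc k)
  have "Ck_on k (\<lambda>x. f x * dirder v g x + dirder v f x * g x) S" for v
    using Suc.prems by (intro Ck_on_add assms Suc.IH Ck_on_SucD[of k] Ck_on_dirder)
  then show ?case
    by (intro Ck_on_SucI[OF assms(1) has_derivative_mult])
      (use Suc in \<open>auto intro: Ck_on_has_derivative\<close>)
qed

lemma Ck_on_inverse:
  fixes f :: "'a::euclidean_space \<Rightarrow> real"
  assumes "open S" "Ck_on k f S" "\<And>x. x \<in> S \<Longrightarrow> f x \<noteq> 0"
  shows "Ck_on k (\<lambda>x. inverse (f x)) S"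
  using assms(2)
proof (induction k)
  case 0
  then show ?case using assms(3) by (simp add: continuous_intros)
next
  case (Suc k)
  have "Ck_on k (\<lambda>x. - 1 * (inverse (f x) * dirder v f x * inverse (f x))) S" for v
    using Suc.prems
    by (intro Ck_on_mult Ck_on_const assms Suc.IH Ck_on_dirder Ck_on_SucD[of k f])
  then have "Ck_on k (\<lambda>x. - (inverse (f x) * dirder v f x * inverse (f x))) S" for v
    by simp
  then show ?case
    by (intro Ck_on_SucI[OF assms(1) Deriv.has_derivative_inverse])
      (use Suc assms(3) in \<open>auto intro: Ck_on_has_derivative\<close>)
qed

lemma Ck_on_sqrt:
  fixes f :: "'a::euclidean_space \<Rightarrow> real"
  assumes "open S" "Ck_on k f S" "\<And>x. x \<in> S \<Longrightarrow> f x > 0"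
  shows "Ck_on k (\<lambda>x. sqrt (f x)) S"
  using assms(2)
proof (induction k)
  case 0
  then show ?case by (simp add: continuous_intros)
next
  case (Suc k)
  have "Ck_on k (\<lambda>x. dirder v f x * (inverse (sqrt (f x)) * (1/2))) S" for v
    using Suc.prems assms(3)
    by (intro Ck_on_mult Ck_on_inverse Ck_on_const assms Suc.IH Ck_on_dirder Ck_on_SucD[of k f])
      (auto simp: less_le)
  then have *: "Ck_on k (\<lambda>x. dirder v f x * (inverse (sqrt (f x)) / 2)) S" for v
    by simp
  show ?case
  proof (rule Ck_on_SucI[OF assms(1) _ *])
    fix x assume "x \<in> S"
    then show "((\<lambda>x. sqrt (f x)) has_derivative (\<lambda>v. dirder v f x * (inverse (sqrt (f x)) / 2))) (at x)"
      using has_derivative_real_sqrt[OF assms(3) Ck_on_has_derivative[OF Suc.prems]] by simp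
  qed
qed

lemma smooth_on_cong:
  "open S \<Longrightarrow> (\<And>z. z \<in> S \<Longrightarrow> f z = g z) \<Longrightarrow> smooth_on S f \<longleftrightarrow> smooth_on S g"
  unfolding smooth_on_def using Ck_on_cong by blast

lemma smooth_on_const: "smooth_on S (\<lambda>x. c)"
  by (simp add: smooth_on_def Ck_on_const)

lemma smooth_on_bounded_linear: "bounded_linear f \<Longrightarrow> open S \<Longrightarrow> smooth_on S f"
  by (simp add: smooth_on_def Ck_on_bounded_linear)

lemma smooth_on_add:
  "open S \<Longrightarrow> smooth_on S f \<Longrightarrow> smooth_on S g \<Longrightarrow> smooth_on S (\<lambda>x. f x + g x)"
  by (simp add: smooth_on_def Ck_on_add)

lemma smooth_on_mult:
  fixes f g :: "'a::euclidean_space \<Rightarrow> real"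
  shows "open S \<Longrightarrow> smooth_on S f \<Longrightarrow> smooth_on S g \<Longrightarrow> smooth_on S (\<lambda>x. f x * g x)"
  by (simp add: smooth_on_def Ck_on_mult)

lemma smooth_on_diff:
  fixes f g :: "'a::euclidean_space \<Rightarrow> real"
  shows "open S \<Longrightarrow> smooth_on S f \<Longrightarrow> smooth_on S g \<Longrightarrow> smooth_on S (\<lambda>x. f x - g x)"
  using smooth_on_add[of S f "\<lambda>x. - 1 * g x"] smooth_on_mult[of S "\<lambda>x. - 1" g] smooth_on_const
  by auto

lemma smooth_on_inverse:
  fixes f :: "'a::euclidean_space \<Rightarrow> real"
  shows "open S \<Longrightarrow> smooth_on S f \<Longrightarrow> (\<And>x. x \<in> S \<Longrightarrow> f x \<noteq> 0) \<Longrightarrow> smooth_on S (\<lambda>x. inverse (f x))"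
  by (simp add: smooth_on_def Ck_on_inverse)

lemma smooth_on_sqrt:
  fixes f :: "'a::euclidean_space \<Rightarrow> real"
  shows "open S \<Longrightarrow> smooth_on S f \<Longrightarrow> (\<And>x. x \<in> S \<Longrightarrow> f x > 0) \<Longrightarrow> smooth_on S (\<lambda>x. sqrt (f x))"
  by (simp add: smooth_on_def Ck_on_sqrt)

lemma smooth_on_sum:
  "open S \<Longrightarrow> (\<And>i. i \<in> I \<Longrightarrow> smooth_on S (f i)) \<Longrightarrow> smooth_on S (\<lambda>x. \<Sum>i\<in>I. f i x)"
  by (induction I rule: infinite_finite_induct) (auto simp: smooth_on_const smooth_on_add)

lemma smooth_on_prod:
  fixes f :: "'i \<Rightarrow> 'a::euclidean_space \<Rightarrow> real"
  shows "open S \<Longrightarrow> (\<And>i. i \<in> I \<Longrightarrow> smooth_on S (f i)) \<Longrightarrow> smooth_on S (\<lambda>x. \<Prod>i\<in>I. f i x)"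
  by (induction I rule: infinite_finite_induct) (auto simp: smooth_on_const smooth_on_mult)

lemma smooth_on_has_derivative:
  "smooth_on S f \<Longrightarrow> x \<in> S \<Longrightarrow> (f has_derivative (\<lambda>v. dirder v f x)) (at x)"
  unfolding smooth_on_def using Ck_on_has_derivative by blast

lemma smooth_on_dirder: "smooth_on S f \<Longrightarrow> smooth_on S (dirder v f)"
  unfolding smooth_on_def using Ck_on_Suc by blast

lemma smooth_on_continuous: "smooth_on S f \<Longrightarrow> continuous_on S f"
  unfolding smooth_on_def using Ck_on.simps(1) by blast

lemma dirder_const: "dirder v (\<lambda>x. c) x = 0"
  by (simp add: dirder_def)

lemma dirder_add:
  "smooth_on S f \<Longrightarrow> smooth_on S g \<Longrightarrow> x \<in> S \<Longrightarrow>
    dirder v (\<lambda>x. f x + g x) x = dirder v f x + dirder v g x"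
  by (intro dirder_eq has_derivative_add smooth_on_has_derivative)

lemma dirder_diff:
  "smooth_on S f \<Longrightarrow> smooth_on S g \<Longrightarrow> x \<in> S \<Longrightarrow>
    dirder v (\<lambda>x. f x - g x) x = dirder v f x - dirder v g x"
  by (intro dirder_eq has_derivative_diff smooth_on_has_derivative)

lemma dirder_mult:
  fixes f g :: "'a::euclidean_space \<Rightarrow> real"
  shows "smooth_on S f \<Longrightarrow> smooth_on S g \<Longrightarrow> x \<in> S \<Longrightarrow>
    dirder v (\<lambda>x. f x * g x) x = f x * dirder v g x + dirder v f x * g x"
  by (intro dirder_eq has_derivative_mult smooth_on_has_derivative)

lemma dirder_cmult:
  fixes f :: "'a::euclidean_space \<Rightarrow> real"
  shows "smooth_on S f \<Longrightarrow> x \<in> S \<Longrightarrow> dirder v (\<lambda>x. c * f x) x = c * dirder v f x"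
  using dirder_mult[OF smooth_on_const] by (simp add: dirder_const)

lemma dirder_sum:
  "(\<And>i. i \<in> I \<Longrightarrow> smooth_on S (f i)) \<Longrightarrow> x \<in> S \<Longrightarrow>
    dirder v (\<lambda>x. \<Sum>i\<in>I. f i x) x = (\<Sum>i\<in>I. dirder v (f i) x)"
  by (intro dirder_eq has_derivative_sum smooth_on_has_derivative)

lemma smooth_on_field_derivative_along_line:
  fixes f :: "'a::euclidean_space \<Rightarrow> real"
  assumes "smooth_on S f" "p + s *\<^sub>R u \<in> S"
  shows "((\<lambda>s. f (p + s *\<^sub>R u)) has_field_derivative dirder u f (p + s *\<^sub>R u)) (at s)"
proof -
  have "((\<lambda>s. p + s *\<^sub>R u) has_derivative (\<lambda>h. h *\<^sub>R u)) (at s)"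
    by (auto intro!: derivative_eq_intros)
  then have "((\<lambda>s. f (p + s *\<^sub>R u)) has_derivative (\<lambda>h. dirder (h *\<^sub>R u) f (p + s *\<^sub>R u))) (at s)"
    using has_derivative_compose smooth_on_has_derivative[OF assms] by blast
  moreover have "dirder (h *\<^sub>R u) f (p + s *\<^sub>R u) = h * dirder u f (p + s *\<^sub>R u)" for h
    using linear_scale[OF has_derivative_linear[OF smooth_on_has_derivative[OF assms]]] by simp
  ultimately show ?thesis
    by (simp add: has_field_derivative_def mult_commute_abs)
qed

text \<open>The mean value theorem, first in direction \<open>u\<close> for the difference of \<open>f\<close> along two parallel
segments, then in direction \<open>v\<close> for \<open>dirder u f\<close>.\<close>

lemma second_difference:
  fixes f :: "'a::euclidean_space \<Rightarrow> real"
  assumes f: "smooth_on S f" and t: "t > 0"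
    and S: "\<And>a b. a \<in> {0..t} \<Longrightarrow> b \<in> {0..t} \<Longrightarrow> z + a *\<^sub>R u + b *\<^sub>R v \<in> S"
  obtains a b where "a \<in> {0..t}" "b \<in> {0..t}"
    "f (z + t *\<^sub>R u + t *\<^sub>R v) - f (z + t *\<^sub>R u) - f (z + t *\<^sub>R v) + f z
      = t\<^sup>2 * dirder v (dirder u f) (z + a *\<^sub>R u + b *\<^sub>R v)"
proof -
  define \<phi> where "\<phi> s = f (z + t *\<^sub>R v + s *\<^sub>R u) - f (z + s *\<^sub>R u)" for s
  define \<phi>' where "\<phi>' s = dirder u f (z + t *\<^sub>R v + s *\<^sub>R u) - dirder u f (z + s *\<^sub>R u)" for s
  have in_S: "z + t *\<^sub>R v + s *\<^sub>R u \<in> S" "z + s *\<^sub>R u \<in> S" if "s \<in> {0..t}" for s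
    using S[OF that, of t] S[OF that, of 0] t by (auto simp: algebra_simps)
  have "(\<phi> has_field_derivative \<phi>' s) (at s)" if "0 \<le> s" "s \<le> t" for s
    unfolding \<phi>_def[abs_def] \<phi>'_def using in_S[of s] that
    by (intro DERIV_diff smooth_on_field_derivative_along_line[OF f]) auto
  from MVT2[OF t this] obtain a where a: "a \<in> {0..t}" "\<phi> t - \<phi> 0 = t * \<phi>' a"
    by (metis atLeastAtMost_iff diff_zero less_imp_le)
  have "((\<lambda>s. dirder u f (z + a *\<^sub>R u + s *\<^sub>R v)) has_field_derivative
      dirder v (dirder u f) (z + a *\<^sub>R u + s *\<^sub>R v)) (at s)" if "0 \<le> s" "s \<le> t" for s
    using S[OF a(1)] that
    by (intro smooth_on_field_derivative_along_line[OF smooth_on_dirder[OF f]]) auto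
  from MVT2[OF t this] obtain b where b: "b \<in> {0..t}"
    "dirder u f (z + a *\<^sub>R u + t *\<^sub>R v) - dirder u f (z + a *\<^sub>R u + 0 *\<^sub>R v) =
      t * dirder v (dirder u f) (z + a *\<^sub>R u + b *\<^sub>R v)"
    by (metis atLeastAtMost_iff diff_zero less_imp_le)
  have "\<phi>' a = t * dirder v (dirder u f) (z + a *\<^sub>R u + b *\<^sub>R v)"
    using b(2) by (simp add: \<phi>'_def algebra_simps)
  then have "\<phi> t - \<phi> 0 = t\<^sup>2 * dirder v (dirder u f) (z + a *\<^sub>R u + b *\<^sub>R v)"
    using a(2) by (simp add: power2_eq_square)
  moreover have "\<phi> t - \<phi> 0
      = f (z + t *\<^sub>R u + t *\<^sub>R v) - f (z + t *\<^sub>R u) - f (z + t *\<^sub>R v) + f z"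
    by (simp add: \<phi>_def algebra_simps)
  ultimately show ?thesis using that[OF a(1) b(1)] by simp
qed

text \<open>The second difference over a parallelogram is symmetric in its two sides.  Read in both orders by
the previous lemma, it equates values of the two mixed derivatives at points that tend to \<open>z\<close> with
the size of the parallelogram.\<close>

lemma dirder_commute:
  fixes f :: "'a::euclidean_space \<Rightarrow> real"
  assumes "open S" "smooth_on S f" "z \<in> S"
  shows "dirder u (dirder v f) z = dirder v (dirder u f) z"
proof -
  let ?A = "dirder v (dirder u f)" and ?B = "dirder u (dirder v f)"
  have "\<bar>?A z - ?B z\<bar> \<le> \<epsilon>" if \<epsilon>: "\<epsilon> > 0" for \<epsilon>
  proof -
    have cont: "isCont ?A z" "isCont ?B z"
      using assms smooth_on_continuous[OF smooth_on_dirder[OF smooth_on_dirder[OF assms(2)]]]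
        continuous_on_eq_continuous_at[OF assms(1)] by blast+
    obtain d1 where d1: "d1 > 0" "\<And>w. dist w z < d1 \<Longrightarrow> dist (?A w) (?A z) < \<epsilon>/2"
      using cont(1) \<epsilon> unfolding continuous_at_eps_delta by (meson half_gt_zero)
    obtain d2 where d2: "d2 > 0" "\<And>w. dist w z < d2 \<Longrightarrow> dist (?B w) (?B z) < \<epsilon>/2"
      using cont(2) \<epsilon> unfolding continuous_at_eps_delta by (meson half_gt_zero)
    obtain d3 where d3: "d3 > 0" "\<And>w. dist w z < d3 \<Longrightarrow> w \<in> S"
      using assms(1,3) unfolding open_dist by blast
    define d where "d = min d1 (min d2 d3)"
    define t where "t = d / (norm u + norm v + 1)"
    have d: "d > 0" using d1 d2 d3 by (simp add: d_def)
    have nuv: "norm u + norm v + 1 > 0" by (smt (verit) norm_ge_zero)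
    have t: "t > 0" using d nuv by (simp add: t_def)
    have near: "dist (z + a *\<^sub>R u + b *\<^sub>R v) z < d" if "a \<in> {0..t}" "b \<in> {0..t}" for a b
    proof -
      have "dist (z + a *\<^sub>R u + b *\<^sub>R v) z = norm (a *\<^sub>R u + b *\<^sub>R v)"
        by (simp add: dist_norm)
      also have "\<dots> \<le> a * norm u + b * norm v"
        using norm_triangle_ineq[of "a *\<^sub>R u" "b *\<^sub>R v"] that by simp
      also have "\<dots> \<le> t * norm u + t * norm v"
        using that by (intro add_mono mult_right_mono) auto
      also have "\<dots> < t * (norm u + norm v + 1)" using t by (simp add: algebra_simps)
      also have "\<dots> = d" using nuv by (simp add: t_def)
      finally show ?thesis .
    qed
    obtain a b where ab: "a \<in> {0..t}" "b \<in> {0..t}"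
      "f (z + t *\<^sub>R u + t *\<^sub>R v) - f (z + t *\<^sub>R u) - f (z + t *\<^sub>R v) + f z
        = t\<^sup>2 * ?A (z + a *\<^sub>R u + b *\<^sub>R v)"
      using second_difference[OF assms(2) t] near d3(2) by (metis d_def min_less_iff_conj)
    have near': "dist (z + a *\<^sub>R v + b *\<^sub>R u) z < d" if "a \<in> {0..t}" "b \<in> {0..t}" for a b
      using near[OF that(2,1)] by (simp add: add.assoc add.commute[of "a *\<^sub>R v"])
    obtain a' b' where ab': "a' \<in> {0..t}" "b' \<in> {0..t}"
      "f (z + t *\<^sub>R v + t *\<^sub>R u) - f (z + t *\<^sub>R v) - f (z + t *\<^sub>R u) + f z
        = t\<^sup>2 * ?B (z + a' *\<^sub>R v + b' *\<^sub>R u)"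
      using second_difference[OF assms(2) t] near' d3(2) by (metis d_def min_less_iff_conj)
    have "t\<^sup>2 * ?A (z + a *\<^sub>R u + b *\<^sub>R v) = t\<^sup>2 * ?B (z + a' *\<^sub>R v + b' *\<^sub>R u)"
      using ab(3) ab'(3) by (simp add: algebra_simps)
    then have "?A (z + a *\<^sub>R u + b *\<^sub>R v) = ?B (z + a' *\<^sub>R v + b' *\<^sub>R u)"
      using t by simp
    moreover have "dist (?A (z + a *\<^sub>R u + b *\<^sub>R v)) (?A z) < \<epsilon>/2"
      using near[OF ab(1,2)] d1(2) by (simp add: d_def)
    moreover have "dist (?B (z + a' *\<^sub>R v + b' *\<^sub>R u)) (?B z) < \<epsilon>/2"
      using near'[OF ab'(1,2)] d2(2) by (simp add: d_def)
    ultimately show ?thesis unfolding dist_real_def by linarith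
  qed
  from this[of "\<bar>?A z - ?B z\<bar> / 2"] show ?thesis by argo
qed

section \<open>Leibniz rule and homogeneous functions\<close>

lemma dx_eq_dirder: "dx i f = dirder (axis i 1, 0) f"
  and dy_eq_dirder: "dy i f = dirder (0, axis i 1) f"
  by (simp_all add: fun_eq_iff dx_def dy_def dirder_def)

text \<open>The summands are grouped by the number of derivatives that fall on \<open>f\<close>; this is the form in which
it meets the curvature conditions.\<close>

lemma dirder_mult3:
  fixes f g :: "'a::euclidean_space \<Rightarrow> real"
  assumes S: "open S" "z \<in> S" and f: "smooth_on S f" and g: "smooth_on S g"
  shows "dirder w (dirder v (dirder u (\<lambda>z. f z * g z))) z =
    f z * dirder w (dirder v (dirder u g)) z
    + dirder w f z * dirder v (dirder u g) z + dirder v f z * dirder w (dirder u g) z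
    + dirder u f z * dirder w (dirder v g) z
    + dirder w (dirder v f) z * dirder u g z + dirder w (dirder u f) z * dirder v g z
    + dirder v (dirder u f) z * dirder w g z
    + dirder w (dirder v (dirder u f)) z * g z"
proof -
  note sm = smooth_on_add smooth_on_mult smooth_on_dirder f g S(1)
  have 1: "dirder u (\<lambda>z. f z * g z) x = f x * dirder u g x + dirder u f x * g x" if "x \<in> S" for x
    using dirder_mult[OF f g that] .
  have 2: "dirder v (dirder u (\<lambda>z. f z * g z)) x =
      f x * dirder v (dirder u g) x + dirder v f x * dirder u g x
      + (dirder u f x * dirder v g x + dirder v (dirder u f) x * g x)" if x: "x \<in> S" for x
  proof -
    have "dirder v (dirder u (\<lambda>z. f z * g z)) x
        = dirder v (\<lambda>x. f x * dirder u g x + dirder u f x * g x) x"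
      by (rule dirder_cong[OF S(1) x 1])
    also have "\<dots> = dirder v (\<lambda>x. f x * dirder u g x) x + dirder v (\<lambda>x. dirder u f x * g x) x"
      by (intro dirder_add[OF _ _ x] sm)
    also have "dirder v (\<lambda>x. f x * dirder u g x) x
        = f x * dirder v (dirder u g) x + dirder v f x * dirder u g x"
      by (intro dirder_mult[OF _ _ x] sm)
    also have "dirder v (\<lambda>x. dirder u f x * g x) x
        = dirder u f x * dirder v g x + dirder v (dirder u f) x * g x"
      by (intro dirder_mult[OF _ _ x] sm)
    finally show ?thesis .
  qed
  have "dirder w (dirder v (dirder u (\<lambda>z. f z * g z))) z
      = dirder w (\<lambda>x. f x * dirder v (dirder u g) x + dirder v f x * dirder u g x
      + (dirder u f x * dirder v g x + dirder v (dirder u f) x * g x)) z"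
    by (rule dirder_cong[OF S 2])
  also have "\<dots> = dirder w (\<lambda>x. f x * dirder v (dirder u g) x + dirder v f x * dirder u g x) z
      + dirder w (\<lambda>x. dirder u f x * dirder v g x + dirder v (dirder u f) x * g x) z"
    by (intro dirder_add[OF _ _ S(2)] sm)
  also have "dirder w (\<lambda>x. f x * dirder v (dirder u g) x + dirder v f x * dirder u g x) z
     = dirder w (\<lambda>x. f x * dirder v (dirder u g) x) z + dirder w (\<lambda>x. dirder v f x * dirder u g x) z"
    by (intro dirder_add[OF _ _ S(2)] sm)
  also have "dirder w (\<lambda>x. dirder u f x * dirder v g x + dirder v (dirder u f) x * g x) z
     = dirder w (\<lambda>x. dirder u f x * dirder v g x) z + dirder w (\<lambda>x. dirder v (dirder u f) x * g x) z"
    by (intro dirder_add[OF _ _ S(2)] sm)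
  also have "dirder w (\<lambda>x. f x * dirder v (dirder u g) x) z
      = f z * dirder w (dirder v (dirder u g)) z + dirder w f z * dirder v (dirder u g) z"
    by (intro dirder_mult[OF _ _ S(2)] sm)
  also have "dirder w (\<lambda>x. dirder v f x * dirder u g x) z
      = dirder v f z * dirder w (dirder u g) z + dirder w (dirder v f) z * dirder u g z"
    by (intro dirder_mult[OF _ _ S(2)] sm)
  also have "dirder w (\<lambda>x. dirder u f x * dirder v g x) z
      = dirder u f z * dirder w (dirder v g) z + dirder w (dirder u f) z * dirder v g z"
    by (intro dirder_mult[OF _ _ S(2)] sm)
  also have "dirder w (\<lambda>x. dirder v (dirder u f) x * g x) z
      = dirder v (dirder u f) z * dirder w g z + dirder w (dirder v (dirder u f)) z * g z"
    by (intro dirder_mult[OF _ _ S(2)] sm)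
  finally show ?thesis by (simp only: add_ac)
qed

text \<open>Homogeneity in \<open>y\<close> is expressed by Euler's differential equation.  In this form it passes through
derivatives and products by the rules of calculus alone.\<close>

definition homogeneous :: "real \<Rightarrow> ((real ^ 'n) \<times> (real ^ 'n)) set \<Rightarrow> 'n::finite field \<Rightarrow> bool" where
  "homogeneous m S f \<longleftrightarrow> (\<forall>z\<in>S. (\<Sum>i\<in>UNIV. snd z $ i * dy i f z) = m * f z)"

lemma smooth_on_dx: "smooth_on S f \<Longrightarrow> smooth_on S (dx i f)"
  and smooth_on_dy: "smooth_on S f \<Longrightarrow> smooth_on S (dy i f)"
  by (simp_all add: dx_eq_dirder dy_eq_dirder smooth_on_dirder)

lemma bounded_linear_y: "bounded_linear (\<lambda>z :: (real ^ 'n::finite) \<times> (real ^ 'n). snd z $ i)"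
  by (rule bounded_linear_compose[OF bounded_linear_vec_nth bounded_linear_snd])

lemma smooth_on_y: "open S \<Longrightarrow> smooth_on S (\<lambda>z :: (real ^ 'n::finite) \<times> (real ^ 'n). snd z $ i)"
  by (rule smooth_on_bounded_linear[OF bounded_linear_y])

lemma dirder_y: "dirder v (\<lambda>z :: (real ^ 'n::finite) \<times> (real ^ 'n). snd z $ i) z = snd v $ i"
  using dirder_eq[OF bounded_linear.has_derivative[OF bounded_linear_y has_derivative_ident]] .

text \<open>The Leibniz rule for the Euler operator and for \<open>y\<^sup>r \<partial>\<^sub>r\<close>, whose weights are the fibre
coordinates.\<close>

lemma dirder_weighted_sum:
  fixes z :: "(real ^ 'n::finite) \<times> (real ^ 'n)"
  assumes "open S" "\<And>i. smooth_on S (g i)" "z \<in> S"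
  shows "dirder v (\<lambda>z. \<Sum>i\<in>UNIV. snd z $ i * g i z) z
     = (\<Sum>i\<in>UNIV. snd z $ i * dirder v (g i) z) + (\<Sum>i\<in>UNIV. snd v $ i * g i z)"
proof -
  have "dirder v (\<lambda>z. \<Sum>i\<in>UNIV. snd z $ i * g i z) z
      = (\<Sum>i\<in>UNIV. dirder v (\<lambda>z. snd z $ i * g i z) z)"
    by (intro dirder_sum[OF _ assms(3)] smooth_on_mult smooth_on_y assms)
  also have "\<dots> = (\<Sum>i\<in>UNIV. snd z $ i * dirder v (g i) z + snd v $ i * g i z)"
    using dirder_mult[OF smooth_on_y[OF assms(1)] assms(2,3)] by (simp add: dirder_y)
  finally show ?thesis by (simp add: sum.distrib)
qed

text \<open>Differentiate Euler's equation in direction \<open>v\<close> and exchange the two derivatives.  The correction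
term comes from the fibre coordinates in the Euler operator: it lowers the degree by one for
vertical \<open>v\<close> and is absent for horizontal \<open>v\<close>.\<close>

lemma homogeneous_dirder:
  fixes f :: "'n::finite field"
  assumes S: "open S" and f: "smooth_on S f" and h: "homogeneous m S f" and z: "z \<in> S"
  shows "(\<Sum>i\<in>UNIV. snd z $ i * dy i (dirder v f) z)
     = m * dirder v f z - (\<Sum>i\<in>UNIV. snd v $ i * dy i f z)"
proof -
  have "m * dirder v f z = dirder v (\<lambda>z. m * f z) z"
    by (rule dirder_cmult[OF f z, symmetric])
  also have "\<dots> = dirder v (\<lambda>z. \<Sum>i\<in>UNIV. snd z $ i * dy i f z) z"
    by (rule dirder_cong[OF S z]) (use h in \<open>simp add: homogeneous_def\<close>)
  also have "\<dots> = (\<Sum>i\<in>UNIV. snd z $ i * dirder v (dy i f) z) + (\<Sum>i\<in>UNIV. snd v $ i * dy i f z)"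
    by (rule dirder_weighted_sum[OF S smooth_on_dy[OF f] z])
  also have "(\<Sum>i\<in>UNIV. snd z $ i * dirder v (dy i f) z) = (\<Sum>i\<in>UNIV. snd z $ i * dy i (dirder v f) z)"
    unfolding dy_eq_dirder using dirder_commute[OF S f z] by simp
  finally show ?thesis by simp
qed

lemma homogeneous_dy:
  assumes "open S" "smooth_on S f" "homogeneous m S f"
  shows "homogeneous (m - 1) S (dy j f)"
  unfolding homogeneous_def
proof
  fix z assume "z \<in> S"
  moreover have "(\<Sum>i\<in>UNIV. axis j 1 $ i * dy i f z) = dy j f z"
    by (simp add: axis_def if_distrib[of "\<lambda>x. x * _"] cong: if_cong)
  ultimately show "(\<Sum>i\<in>UNIV. snd z $ i * dy i (dy j f) z) = (m - 1) * dy j f z"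
    using homogeneous_dirder[OF assms, of z "(0, axis j 1)"]
    by (simp add: dy_eq_dirder[of j] algebra_simps)
qed

lemma homogeneous_dx:
  assumes "open S" "smooth_on S f" "homogeneous m S f"
  shows "homogeneous m S (dx j f)"
  using homogeneous_dirder[OF assms, of _ "(axis j 1, 0)"]
  by (simp add: homogeneous_def dx_eq_dirder)

lemma homogeneous_y:
  "homogeneous 1 S (\<lambda>z :: (real ^ 'n::finite) \<times> (real ^ 'n). snd z $ r)"
  by (simp add: homogeneous_def dy_eq_dirder dirder_y axis_def if_distrib[of "\<lambda>x. _ * x"] cong: if_cong)

lemma homogeneous_mult:
  assumes "smooth_on S f" "smooth_on S g" "homogeneous a S f" "homogeneous b S g"
  shows "homogeneous (a + b) S (\<lambda>z. f z * g z)"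
  unfolding homogeneous_def
proof
  fix z assume z: "z \<in> S"
  have "(\<Sum>i\<in>UNIV. snd z $ i * dy i (\<lambda>z. f z * g z) z)
      = f z * (\<Sum>i\<in>UNIV. snd z $ i * dy i g z) + g z * (\<Sum>i\<in>UNIV. snd z $ i * dy i f z)"
    unfolding dy_eq_dirder dirder_mult[OF assms(1,2) z]
    by (simp add: sum_distrib_left sum.distrib algebra_simps)
  also have "\<dots> = (a + b) * (f z * g z)"
    using assms(3,4) z by (simp add: homogeneous_def algebra_simps)
  finally show "(\<Sum>i\<in>UNIV. snd z $ i * dy i (\<lambda>z. f z * g z) z) = (a + b) * (f z * g z)" .
qed

lemma homogeneous_cmult:
  assumes "smooth_on S f" "homogeneous a S f"
  shows "homogeneous a S (\<lambda>z. c * f z)"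
  using assms(2) dirder_cmult[OF assms(1)]
  by (simp add: homogeneous_def dy_eq_dirder mult.left_commute[of _ c] flip: sum_distrib_left)

lemma homogeneous_diff:
  assumes "smooth_on S f" "smooth_on S g" "homogeneous a S f" "homogeneous a S g"
  shows "homogeneous a S (\<lambda>z. f z - g z)"
  using assms(3,4) dirder_diff[OF assms(1,2)]
  by (simp add: homogeneous_def dy_eq_dirder right_diff_distrib sum_subtractf)

lemma homogeneous_sum:
  assumes "\<And>r. r \<in> I \<Longrightarrow> smooth_on S (f r)" "\<And>r. r \<in> I \<Longrightarrow> homogeneous a S (f r)"
  shows "homogeneous a S (\<lambda>z. \<Sum>r\<in>I. f r z)"
  unfolding homogeneous_def
proof
  fix z assume z: "z \<in> S"
  have "dy i (\<lambda>z. \<Sum>r\<in>I. f r z) z = (\<Sum>r\<in>I. dy i (f r) z)" for i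
    unfolding dy_eq_dirder by (rule dirder_sum[OF _ z]) (rule assms(1))
  then have "(\<Sum>i\<in>UNIV. snd z $ i * dy i (\<lambda>z. \<Sum>r\<in>I. f r z) z)
      = (\<Sum>r\<in>I. \<Sum>i\<in>UNIV. snd z $ i * dy i (f r) z)"
    by (simp add: sum_distrib_left) (rule sum.swap)
  also have "\<dots> = a * (\<Sum>r\<in>I. f r z)"
    using assms(2) z by (simp add: homogeneous_def sum_distrib_left)
  finally show "(\<Sum>i\<in>UNIV. snd z $ i * dy i (\<lambda>z. \<Sum>r\<in>I. f r z) z) = a * (\<Sum>r\<in>I. f r z)" .
qed

text \<open>Euler's theorem: both sides are the derivative of \<open>s \<mapsto> f (x, (1 + s) y)\<close> at \<open>s = 0\<close>.\<close>

lemma homogeneous_of_scaling: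
  fixes f :: "'n::finite field"
  assumes S: "open S" "smooth_on S f"
    and sc: "\<And>x y t. (x, y) \<in> S \<Longrightarrow> t > 0 \<Longrightarrow> (x, t *\<^sub>R y) \<in> S \<Longrightarrow> f (x, t *\<^sub>R y) = t * f (x, y)"
  shows "homogeneous 1 S f"
  unfolding homogeneous_def
proof
  fix z assume z: "z \<in> S"
  obtain x y where xy: "z = (x, y)" by force
  have "((\<lambda>s. f (z + s *\<^sub>R (0, y))) has_field_derivative dirder (0, y) f z) (at 0)"
    using smooth_on_field_derivative_along_line[OF S(2), of z 0 "(0, y)"] z
    by (simp flip: zero_prod_def)
  moreover have "((\<lambda>s. f (z + s *\<^sub>R (0, y))) has_field_derivative f z) (at 0)"
  proof (rule has_field_derivative_transform_within_open[of "\<lambda>s. (1 + s) * f z"])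
    show "((\<lambda>s. (1 + s) * f z) has_field_derivative f z) (at 0)"
      by (auto intro!: derivative_eq_intros)
    show "open ({s. z + s *\<^sub>R (0, y) \<in> S} \<inter> {-1<..})"
      by (intro open_Int open_greaterThan open_vimage[of S "\<lambda>s. z + s *\<^sub>R (0, y)", unfolded vimage_def] S(1)
          continuous_intros)
    show "0 \<in> {s. z + s *\<^sub>R (0, y) \<in> S} \<inter> {-1<..}" using z by (simp flip: zero_prod_def)
    show "(1 + s) * f z = f (z + s *\<^sub>R (0, y))" if "s \<in> {s. z + s *\<^sub>R (0, y) \<in> S} \<inter> {-1<..}" for s
    proof -
      have "z + s *\<^sub>R (0, y) = (x, (1 + s) *\<^sub>R y)" by (simp add: xy algebra_simps)
      then show ?thesis using sc[of x y "1 + s"] that z xy by simp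
    qed
  qed
  ultimately have "dirder (0, y) f z = f z"
    by (rule DERIV_unique)
  moreover have "dirder (0, y) f z = (\<Sum>i\<in>UNIV. y $ i * dy i f z)"
  proof -
    let ?L = "\<lambda>v. dirder v f z"
    have L: "linear ?L"
      by (rule has_derivative_linear[OF smooth_on_has_derivative[OF S(2) z]])
    have "(0, y) = (\<Sum>i\<in>UNIV. y $ i *\<^sub>R (0 :: real ^ 'n, axis i 1 :: real ^ 'n))"
      by (simp add: prod_eq_iff fst_sum snd_sum vec_eq_iff axis_def if_distrib cong: if_cong)
    then have "?L (0, y) = (\<Sum>i\<in>UNIV. ?L (y $ i *\<^sub>R (0, axis i 1)))"
      using linear_sum[OF L] by simp
    moreover have "?L (c *\<^sub>R w) = c * ?L w" for c w
      using linear_scale[OF L, of c w] by simp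
    ultimately show ?thesis by (simp only: dy_eq_dirder)
  qed
  ultimately show "(\<Sum>i\<in>UNIV. snd z $ i * dy i f z) = 1 * f z"
    by (simp add: xy)
qed

lemma smooth_on_det:
  fixes a :: "'i::finite \<Rightarrow> 'i \<Rightarrow> 'a::euclidean_space \<Rightarrow> real"
  assumes "open S" "\<And>i j. smooth_on S (a i j)"
  shows "smooth_on S (\<lambda>z. det (\<chi> i j. a i j z))"
  unfolding det_def
  by (simp, intro smooth_on_sum smooth_on_mult smooth_on_const smooth_on_prod assms)

section \<open>Finsler geometry in one chart\<close>

lemma matrix_inv_right:
  fixes A :: "real ^ 'n ^ 'n"
  assumes "invertible A"
  shows "A ** matrix_inv A = mat 1"
  using assms unfolding matrix_inv_def invertible_def by (rule someI2_ex) simp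

text \<open>A Finsler function seen in one chart, on a set \<open>S\<close> of coordinate pairs \<open>(x, y)\<close>.\<close>

locale local_finsler =
  fixes f :: "'n::finite field" and S :: "((real ^ 'n) \<times> (real ^ 'n)) set"
  assumes S: "open S" and smooth: "smooth_on S f" and hom: "homogeneous 1 S f"
    and nondegenerate: "\<And>z. z \<in> S \<Longrightarrow> invertible (metric_matrix f z)"
begin

lemma dy_cong: "z \<in> S \<Longrightarrow> (\<And>z. z \<in> S \<Longrightarrow> p z = q z) \<Longrightarrow> dy i p z = dy i q z"
  unfolding dy_eq_dirder by (rule dirder_cong[OF S])

lemma dy_commute: "smooth_on S p \<Longrightarrow> z \<in> S \<Longrightarrow> dy i (dy j p) z = dy j (dy i p) z"
  unfolding dy_eq_dirder by (rule dirder_commute[OF S])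

lemma dy_cmult: "smooth_on S p \<Longrightarrow> z \<in> S \<Longrightarrow> dy i (\<lambda>z. c * p z) z = c * dy i p z"
  unfolding dy_eq_dirder by (rule dirder_cmult)

lemma smooth_cmult: "smooth_on S p \<Longrightarrow> smooth_on S (\<lambda>z. c * p z :: real)"
  by (rule smooth_on_mult[OF S smooth_on_const])

lemma sq_eq: "sq f = (\<lambda>z. f z * f z)"
  by (simp add: fun_eq_iff sq_def power2_eq_square)

lemma smooth_sq: "smooth_on S (sq f)"
  unfolding sq_eq by (intro smooth_on_mult S smooth)

lemma homogeneous_sq: "homogeneous 2 S (sq f)"
  unfolding sq_eq using homogeneous_mult[OF smooth smooth hom hom] by simp

lemma metric_eq: "metric f i j = (\<lambda>z. 1/2 * dy i (dy j (sq f)) z)"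
  by (simp add: fun_eq_iff metric_def)

lemma smooth_metric: "smooth_on S (metric f i j)"
  unfolding metric_eq by (intro smooth_cmult smooth_on_dy smooth_sq)

lemma homogeneous_metric: "homogeneous 0 S (metric f i j)"
  unfolding metric_eq
  using homogeneous_dy[OF S _ homogeneous_dy[OF S _ homogeneous_sq]]
  by (intro homogeneous_cmult smooth_on_dy smooth_sq) (simp add: smooth_sq smooth_on_dy)

lemma metric_sym: "z \<in> S \<Longrightarrow> metric f i j z = metric f j i z"
  by (simp add: metric_def dy_commute[OF smooth_sq])

lemma cartan_eq: "cartan f i j k = (\<lambda>z. 1/2 * dy k (metric f i j) z)"
  by (simp add: fun_eq_iff cartan_def)

lemma smooth_cartan: "smooth_on S (cartan f i j k)"
  unfolding cartan_eq by (intro smooth_cmult smooth_on_dy smooth_metric)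

lemma homogeneous_cartan: "homogeneous (-1) S (cartan f i j k)"
  unfolding cartan_eq
  using homogeneous_dy[OF S smooth_metric homogeneous_metric]
  by (intro homogeneous_cmult smooth_on_dy smooth_metric) simp

lemma homogeneous_cartan1: "homogeneous (-2) S (cartan1 f i j k h)"
  unfolding cartan1_def using homogeneous_dy[OF S smooth_cartan homogeneous_cartan] by simp

lemma cartan_swap: "z \<in> S \<Longrightarrow> cartan f i j k z = cartan f j i k z"
  unfolding cartan_def using dy_cong[OF _ metric_sym] by simp

text \<open>The Cartan tensor is a third \<open>y\<close>-derivative of \<open>F\<^sup>2\<close> up to a factor, hence totally symmetric.  The
transposition and the rotation of indices generate all the symmetries that are used.\<close>

lemma cartan_rotate:
  assumes "z \<in> S"
  shows "cartan f i j k z = cartan f j k i z"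
proof -
  have c: "cartan f a b c z = 1/4 * dy c (dy a (dy b (sq f))) z" for a b c
    unfolding cartan_eq metric_eq dy_cmult[OF smooth_on_dy[OF smooth_on_dy[OF smooth_sq]] assms]
    by simp
  have "dy k (dy i (dy j (sq f))) z = dy i (dy k (dy j (sq f))) z"
    by (rule dy_commute[OF smooth_on_dy[OF smooth_sq] assms])
  also have "\<dots> = dy i (dy j (dy k (sq f))) z"
    by (rule dy_cong[OF assms dy_commute[OF smooth_sq]])
  finally show ?thesis by (simp add: c)
qed

lemma cartan1_swap12: "z \<in> S \<Longrightarrow> cartan1 f i j k h z = cartan1 f j i k h z"
  unfolding cartan1_def by (intro dy_cong cartan_swap)

lemma cartan1_swap34:
  assumes z: "z \<in> S"
  shows "cartan1 f i j k h z = cartan1 f i j h k z"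
  unfolding cartan1_def cartan_eq dy_cmult[OF smooth_on_dy[OF smooth_metric] z]
  by (simp add: dy_commute[OF smooth_metric z, of h k])

lemma cartan1_rotate:
  assumes z: "z \<in> S"
  shows "cartan1 f i j k h z = cartan1 f j k h i z"
proof -
  have "cartan1 f i j k h z = cartan1 f j k i h z"
    unfolding cartan1_def by (rule dy_cong[OF z cartan_rotate])
  also have "\<dots> = cartan1 f j k h i z" by (rule cartan1_swap34[OF z])
  finally show ?thesis .
qed

text \<open>Any index may be regarded as the one of the last derivative.  With the first index in this role,
a contraction with \<open>y\<^sup>i\<close> becomes the Euler operator, and only degrees have to be counted.\<close>

lemma cartan1_eq_first: "z \<in> S \<Longrightarrow> cartan1 f i j k h z = dy i (cartan f j k h) z"
  using cartan1_rotate[of z i j k h] by (simp add: cartan1_def)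

lemma cartan2_eq_first:
  assumes "z \<in> S"
  shows "cartan2 f i j k h l z = dy i (cartan1 f j k h l) z"
proof -
  have "cartan2 f i j k h l z = dy l (dy i (cartan f j k h)) z"
    unfolding cartan2_def by (rule dy_cong[OF assms cartan1_eq_first])
  also have "\<dots> = dy i (cartan1 f j k h l) z"
    unfolding cartan1_def by (rule dy_commute[OF smooth_cartan assms])
  finally show ?thesis .
qed

lemma contract_cartan: "z \<in> S \<Longrightarrow> (\<Sum>i\<in>UNIV. snd z $ i * cartan f j k i z) = 0"
  using homogeneous_metric[of j k]
  by (simp add: cartan_def homogeneous_def flip: sum_divide_distrib)

lemma contract_cartan1: "z \<in> S \<Longrightarrow> (\<Sum>i\<in>UNIV. snd z $ i * cartan1 f i j k h z) = - cartan f j k h z"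
  using homogeneous_cartan[of j k h] by (simp add: cartan1_eq_first homogeneous_def)

lemma contract_cartan2:
  "z \<in> S \<Longrightarrow> (\<Sum>i\<in>UNIV. snd z $ i * cartan2 f i j k h l z) = - 2 * cartan1 f j k h l z"
  using homogeneous_cartan1[of j k h l] by (simp add: cartan2_eq_first homogeneous_def)

text \<open>This is \<open>H\<^sub>i\<close> in the form that contains no inverse matrix; half of the Euler-Lagrange expression of
\<open>F\<^sup>2 / 2\<close> along straight lines.\<close>

definition euler_lagrange :: "'n \<Rightarrow> 'n field" where
  "euler_lagrange i z = 1/4 * ((\<Sum>r\<in>UNIV. snd z $ r * dx r (dy i (sq f)) z) - dx i (sq f) z)"

lemma smooth_euler_lagrange: "smooth_on S (euler_lagrange i)"
  unfolding euler_lagrange_def[abs_def]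
  by (intro smooth_cmult smooth_on_diff smooth_on_sum smooth_on_mult smooth_on_y S
      smooth_on_dx smooth_on_dy smooth_sq)

lemma homogeneous_euler_lagrange: "homogeneous 2 S (euler_lagrange i)"
proof -
  note sm = smooth_cmult smooth_on_diff smooth_on_sum smooth_on_mult smooth_on_y S
      smooth_on_dx smooth_on_dy smooth_sq
  have dxdy: "smooth_on S (dx r (dy i (sq f)))" for r
    by (intro smooth_on_dx smooth_on_dy smooth_sq)
  have "homogeneous 1 S (dx r (dy i (sq f)))" for r
    using homogeneous_dx[OF S smooth_on_dy[OF smooth_sq] homogeneous_dy[OF S smooth_sq homogeneous_sq]]
    by simp
  then have "homogeneous 2 S (\<lambda>z. snd z $ r * dx r (dy i (sq f)) z)" for r
    using homogeneous_mult[OF smooth_on_y[OF S] dxdy homogeneous_y] by fastforce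
  moreover have "homogeneous 2 S (dx i (sq f))"
    by (rule homogeneous_dx[OF S smooth_sq homogeneous_sq])
  ultimately show ?thesis
    unfolding euler_lagrange_def[abs_def]
    by (intro homogeneous_cmult homogeneous_diff homogeneous_sum sm)
qed

lemma metric_spray:
  assumes "z \<in> S"
  shows "(\<Sum>r\<in>UNIV. metric f i r z * spray f r z) = euler_lagrange i z"
proof -
  let ?G = "metric_matrix f z" and ?e = "\<chi> h. euler_lagrange h z"
  have spray: "(\<chi> r. spray f r z) = matrix_inv ?G *v ?e"
    by (simp add: vec_eq_iff spray_def euler_lagrange_def matrix_vector_mult_def sum_distrib_left
        algebra_simps)
  have "?G *v (\<chi> r. spray f r z) = ?e"
    using matrix_inv_right[OF nondegenerate[OF assms]]
    by (simp add: spray matrix_vector_mul_assoc)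
  then show ?thesis
    by (simp add: vec_eq_iff matrix_vector_mult_def metric_matrix_def)
qed

text \<open>The form in which invertibility of the metric is used: an index can be lowered without loss.\<close>

lemma metric_kernel:
  assumes "z \<in> S" "\<And>i. (\<Sum>r\<in>UNIV. metric f i r z * w r) = 0"
  shows "w r = 0"
proof -
  have "metric_matrix f z *v (\<chi> r. w r) = 0"
    using assms(2) by (simp add: vec_eq_iff matrix_vector_mult_def metric_matrix_def)
  then have "(\<chi> r. w r) = 0"
    using nondegenerate[OF assms(1)] matrix_left_invertible_ker invertible_left_inverse by metis
  then show ?thesis by (simp add: vec_eq_iff)
qed

text \<open>Cramer's rule writes the spray coefficients as a quotient of two determinants with smooth entries.\<close>

lemma smooth_spray: "smooth_on S (spray f k)"
proof -
  let ?num = "\<lambda>z. det (\<chi> i j. if j = k then euler_lagrange i z else metric f i j z)"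
  let ?den = "\<lambda>z. det (\<chi> i j. metric f i j z)"
  have den: "?den z \<noteq> 0" if "z \<in> S" for z
    using nondegenerate[OF that] by (simp add: invertible_det_nz metric_matrix_def)
  have "spray f k z = ?num z * inverse (?den z)" if z: "z \<in> S" for z
  proof -
    have "metric_matrix f z *v (\<chi> r. spray f r z) = (\<chi> h. euler_lagrange h z)"
      using metric_spray[OF z] by (simp add: vec_eq_iff matrix_vector_mult_def metric_matrix_def)
    moreover have "det (metric_matrix f z) \<noteq> 0" using den[OF z] by (simp add: metric_matrix_def)
    ultimately have "(\<chi> r. spray f r z) = (\<chi> k. det (\<chi> i j. if j = k then (\<chi> h. euler_lagrange h z) $ i
          else metric_matrix f z $ i $ j) / det (metric_matrix f z))"
      by (simp add: cramer)
    then show ?thesis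
      by (simp add: vec_eq_iff metric_matrix_def divide_inverse cong: if_cong)
  qed
  moreover have "smooth_on S (\<lambda>z. ?num z * inverse (?den z))"
  proof -
    have "smooth_on S (\<lambda>z. if j = k then euler_lagrange i z else metric f i j z)" for i j
      by (cases "j = k") (simp_all add: smooth_euler_lagrange smooth_metric)
    then have "smooth_on S ?num" by (rule smooth_on_det[OF S])
    moreover have "smooth_on S (\<lambda>z. inverse (?den z))"
      by (rule smooth_on_inverse[OF S smooth_on_det[OF S smooth_metric] den])
    ultimately show ?thesis by (rule smooth_on_mult[OF S])
  qed
  ultimately show ?thesis
    using smooth_on_cong[OF S, of "spray f k" "\<lambda>z. ?num z * inverse (?den z)"] by blast
qed

text \<open>The metric has degree \<open>0\<close> and \<open>H\<^sub>i\<close> has degree \<open>2\<close>, so the Euler operator applied to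
\<open>g\<^sub>i\<^sub>r G\<^sup>r = H\<^sub>i\<close> shows that \<open>g\<close> annihilates the defect of Euler's equation for \<open>G\<close>.\<close>

lemma homogeneous_spray: "homogeneous 2 S (spray f r)"
  unfolding homogeneous_def
proof
  fix z assume z: "z \<in> S"
  let ?E = "\<lambda>p. \<Sum>i\<in>UNIV. snd z $ i * dy i p z"
  have "(\<Sum>r\<in>UNIV. metric f i r z * (?E (spray f r) - 2 * spray f r z)) = 0" for i
  proof -
    have "?E (\<lambda>z. metric f i r z * spray f r z)
        = metric f i r z * ?E (spray f r) + ?E (metric f i r) * spray f r z" for r
      unfolding dy_eq_dirder dirder_mult[OF smooth_metric smooth_spray z]
      by (simp add: sum_distrib_left sum_distrib_right sum.distrib algebra_simps)
    then have 1: "?E (\<lambda>z. metric f i r z * spray f r z) = metric f i r z * ?E (spray f r)" for r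
      using homogeneous_metric z by (simp add: homogeneous_def)
    have "2 * (\<Sum>r\<in>UNIV. metric f i r z * spray f r z) = 2 * euler_lagrange i z"
      by (simp add: metric_spray z)
    also have "\<dots> = ?E (euler_lagrange i)"
      using homogeneous_euler_lagrange z by (simp add: homogeneous_def)
    also have "\<dots> = ?E (\<lambda>z. \<Sum>r\<in>UNIV. metric f i r z * spray f r z)"
      using dy_cong[OF z metric_spray] by simp
    also have "\<dots> = (\<Sum>r\<in>UNIV. ?E (\<lambda>z. metric f i r z * spray f r z))"
    proof -
      have "dy j (\<lambda>z. \<Sum>r\<in>UNIV. metric f i r z * spray f r z) z
          = (\<Sum>r\<in>UNIV. dy j (\<lambda>z. metric f i r z * spray f r z) z)" for j
        unfolding dy_eq_dirder
        by (intro dirder_sum[OF _ z] smooth_on_mult S smooth_metric smooth_spray)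
      then show ?thesis by (simp add: sum_distrib_left) (rule sum.swap)
    qed
    also have "\<dots> = (\<Sum>r\<in>UNIV. metric f i r z * ?E (spray f r))"
      by (simp only: 1)
    finally show ?thesis
      by (simp add: right_diff_distrib sum_subtractf sum_distrib_left algebra_simps)
  qed
  from metric_kernel[OF z this] show "?E (spray f r) = 2 * spray f r z" by simp
qed

text \<open>The left-hand side of the condition under which the two Berwald notions agree.\<close>

definition berwald_term :: "'n \<Rightarrow> 'n \<Rightarrow> 'n \<Rightarrow> 'n \<Rightarrow> 'n field" where
  "berwald_term i j k h z = (\<Sum>r\<in>UNIV. cartan2 f i r j k h z * spray f r z) +
     cyclic_sum (\<lambda>j k h. \<Sum>r\<in>UNIV.
       cartan1 f i r j k z * spray1 f r h z + cartan f i r j z * spray2 f r k h z) j k h"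

text \<open>The Leibniz rule for \<open>g\<^sub>i\<^sub>r G\<^sup>r\<close>.  Of the eight summands, the one without a derivative on \<open>g\<close> is the
lowered Berwald curvature; the other seven are, by the symmetry of second derivatives, twice the
terms of the condition.\<close>

lemma Hcov3_eq:
  assumes z: "z \<in> S"
  shows "Hcov3 f i j k h z
    = (\<Sum>r\<in>UNIV. metric f i r z * spray3 f r j k h z) + 2 * berwald_term i j k h z"
proof -
  note sm = smooth_on_mult S smooth_metric smooth_spray smooth_on_dirder smooth_on_sum
  let ?D = "\<lambda>i. dirder (0, axis i (1::real)) :: 'n field \<Rightarrow> 'n field"
  let ?p = "\<lambda>r z. metric f i r z * spray f r z"
  have "Hcov f i = (\<lambda>z. \<Sum>r\<in>UNIV. ?p r z)"
    by (simp add: fun_eq_iff Hcov_def)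
  then have "Hcov3 f i j k h z = ?D h (?D k (?D j (\<lambda>z. \<Sum>r\<in>UNIV. ?p r z))) z"
    by (simp add: Hcov3_def Hcov2_def Hcov1_def dy_eq_dirder)
  also have "\<dots> = ?D h (?D k (\<lambda>z. \<Sum>r\<in>UNIV. ?D j (?p r) z)) z"
    by (intro dirder_cong[OF S] z dirder_sum[where S = S] sm)
  also have "\<dots> = ?D h (\<lambda>z. \<Sum>r\<in>UNIV. ?D k (?D j (?p r)) z) z"
    by (intro dirder_cong[OF S] z dirder_sum[where S = S] sm)
  also have "\<dots> = (\<Sum>r\<in>UNIV. ?D h (?D k (?D j (?p r))) z)"
    by (intro dirder_sum[OF _ z] sm)
  also have "\<dots> = (\<Sum>r\<in>UNIV. metric f i r z * spray3 f r j k h z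
      + 2 * (cartan2 f i r j k h z * spray f r z
      + (cartan1 f i r j k z * spray1 f r h z + cartan f i r j z * spray2 f r k h z)
      + (cartan1 f i r k h z * spray1 f r j z + cartan f i r k z * spray2 f r h j z)
      + (cartan1 f i r h j z * spray1 f r k z + cartan f i r h z * spray2 f r j k z)))"
  proof (rule sum.cong[OF refl])
    fix r
    have c: "?D a (metric f i r) = (\<lambda>z. 2 * cartan f i r a z)" for a
      by (simp add: cartan_def fun_eq_iff dy_eq_dirder)
    have c1: "?D b (?D a (metric f i r)) x = 2 * cartan1 f i r a b x" if "x \<in> S" for a b x
      unfolding c cartan1_def dy_eq_dirder by (rule dirder_cmult[OF smooth_cartan that])
    have c2: "?D d (?D b (?D a (metric f i r))) z = 2 * cartan2 f i r a b d z" for a b d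
    proof -
      have "?D d (?D b (?D a (metric f i r))) z = ?D d (\<lambda>x. 2 * cartan1 f i r a b x) z"
        by (rule dirder_cong[OF S z c1])
      also have "\<dots> = 2 * cartan2 f i r a b d z"
        unfolding cartan2_def cartan1_def dy_eq_dirder
        by (intro dirder_cmult[OF _ z] smooth_on_dirder smooth_cartan)
      finally show ?thesis .
    qed
    have s: "?D a (spray f r) = spray1 f r a" "?D b (spray1 f r a) = spray2 f r a b"
      "?D d (spray2 f r a b) = spray3 f r a b d" for a b d
      by (simp_all add: spray1_def spray2_def spray3_def dy_eq_dirder)
    have sym: "cartan1 f i r h j z = cartan1 f i r j h z" "spray2 f r h j z = spray2 f r j h z"
      using cartan1_swap34[OF z] dy_commute[OF smooth_spray z] by (simp_all add: spray2_def spray1_def)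
    show "?D h (?D k (?D j (?p r))) z = metric f i r z * spray3 f r j k h z
      + 2 * (cartan2 f i r j k h z * spray f r z
      + (cartan1 f i r j k z * spray1 f r h z + cartan f i r j z * spray2 f r k h z)
      + (cartan1 f i r k h z * spray1 f r j z + cartan f i r k z * spray2 f r h j z)
      + (cartan1 f i r h j z * spray1 f r k z + cartan f i r h z * spray2 f r j k z))"
      unfolding dirder_mult3[OF S z smooth_metric smooth_spray] c1[OF z] c2 s sym
      unfolding c by (simp add: algebra_simps)
  qed
  finally show ?thesis
    by (simp only: berwald_term_def cyclic_sum_def sum.distrib sum_distrib_left[symmetric] add.assoc)
qed

lemma Hcov3_zero_iff:
  assumes z: "z \<in> S" and "\<And>i. berwald_term i j k h z = 0"
  shows "(\<forall>i. Hcov3 f i j k h z = 0) \<longleftrightarrow> (\<forall>r. spray3 f r j k h z = 0)"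
  using metric_kernel[OF z, of "\<lambda>r. spray3 f r j k h z"] assms(2) by (auto simp: Hcov3_eq[OF z])

definition cartan1_spray :: "'n \<Rightarrow> 'n \<Rightarrow> 'n \<Rightarrow> 'n field" where
  "cartan1_spray j k h z = (\<Sum>r\<in>UNIV. cartan1 f r j k h z * spray f r z)"

definition cartan_spray1 :: "'n \<Rightarrow> 'n \<Rightarrow> 'n \<Rightarrow> 'n field" where
  "cartan_spray1 j k h z = (\<Sum>r\<in>UNIV. cartan f r j k z * spray1 f r h z)"

text \<open>The factors \<open>-2\<close> and \<open>-1\<close> are the degrees of \<open>C\<^sub>r\<^sub>j\<^sub>k\<^sub>h\<close> and \<open>C\<^sub>r\<^sub>j\<^sub>k\<close>; the summands with \<open>G\<^sup>r\<^sub>j\<^sub>k\<close> disappear because the Cartan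
tensor is annihilated by \<open>y\<close>.\<close>

lemma contract_berwald_term:
  assumes z: "z \<in> S"
  shows "(\<Sum>i\<in>UNIV. snd z $ i * berwald_term i j k h z)
    = - 2 * cartan1_spray j k h z - cyclic_sum (\<lambda>j k h. cartan_spray1 j k h z) j k h"
proof -
  have 1: "(\<Sum>i\<in>UNIV. snd z $ i * (\<Sum>r\<in>UNIV. a i r * b r)) = (\<Sum>r\<in>UNIV. (\<Sum>i\<in>UNIV. snd z $ i * a i r) * b r)"
    for a :: "'n \<Rightarrow> 'n \<Rightarrow> real" and b
    unfolding sum_distrib_left sum_distrib_right mult.assoc by (rule sum.swap)
  have c: "(\<Sum>i\<in>UNIV. snd z $ i * cartan f i j k z) = 0" for j k
    using contract_cartan[OF z, of j k] by (simp only: cartan_rotate[OF z, of _ j k])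
  have "(\<Sum>i\<in>UNIV. snd z $ i * (\<Sum>r\<in>UNIV. cartan2 f i r j k h z * spray f r z)) = - 2 * cartan1_spray j k h z"
    unfolding 1 contract_cartan2[OF z] cartan1_spray_def by (simp add: sum_distrib_left mult.assoc sum_negf)
  moreover have "(\<Sum>i\<in>UNIV. snd z $ i * (\<Sum>r\<in>UNIV.
      cartan1 f i r j k z * spray1 f r h z + cartan f i r j z * spray2 f r k h z)) = - cartan_spray1 j k h z" for j k h
    unfolding sum.distrib distrib_left 1 c contract_cartan1[OF z] cartan_spray1_def
    by (simp add: sum_negf)
  ultimately show ?thesis
    unfolding berwald_term_def cyclic_sum_def distrib_left sum.distrib by simp
qed

lemma Lcov_eq:
  assumes z: "z \<in> S"
  shows "Lcov f j k h z =
    (\<Sum>i\<in>UNIV. \<Sum>r\<in>UNIV. snd z $ i * metric f i r z * spray3 f r j k h z)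
    - 4 * cartan1_spray j k h z - 2 * cyclic_sum (\<lambda>j k h. cartan_spray1 j k h z) j k h"
proof -
  have "Lcov f j k h z = (\<Sum>i\<in>UNIV. \<Sum>r\<in>UNIV. snd z $ i * metric f i r z * spray3 f r j k h z)
      + 2 * (\<Sum>i\<in>UNIV. snd z $ i * berwald_term i j k h z)"
    unfolding Lcov_def Hcov3_eq[OF z] distrib_left sum.distrib sum_distrib_left
    by (simp add: mult_ac)
  then show ?thesis unfolding contract_berwald_term[OF z] by simp
qed

lemma cartan1_cycle:
  assumes z: "z \<in> S"
  shows "cartan1 f r k h j z = cartan1 f r j k h z"
proof -
  have "cartan1 f r k h j z = cartan1 f j r k h z" by (rule cartan1_rotate[OF z, symmetric])
  also have "\<dots> = cartan1 f r j k h z" by (rule cartan1_swap12[OF z])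
  finally show ?thesis .
qed

lemma cartan1_spray_cycle: "z \<in> S \<Longrightarrow> cartan1_spray k h j z = cartan1_spray j k h z"
  unfolding cartan1_spray_def using cartan1_cycle[of z _ k h j] by simp

text \<open>The condition couples two expressions, and \<open>Lcov_eq\<close> contains them in a different proportion.  A
second, independent linear relation between them comes from the contraction
\<open>C\<^sub>r\<^sub>j\<^sub>k G\<^sup>r\<close>, which vanishes identically and can therefore be differentiated.  For this the condition
is needed on all of \<open>S\<close>, even for the conclusion at a single point.\<close>

lemma landsberg_condition_splits:
  assumes cond: "\<And>z j k h. z \<in> S \<Longrightarrow> cartan1_spray j k h z + cyclic_sum (\<lambda>j k h. cartan_spray1 j k h z) j k h = 0"
    and z: "z \<in> S"
  shows "cartan1_spray j k h z = 0" "cyclic_sum (\<lambda>j k h. cartan_spray1 j k h z) j k h = 0"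
proof -
  define cartan_spray where "cartan_spray j k z = (\<Sum>r\<in>UNIV. cartan f r j k z * spray f r z)" for j k z
  \<comment> \<open>Contract the condition with \<open>y\<^sup>h\<close>: its four terms become \<open>-1\<close>, \<open>2\<close>, \<open>0\<close> and \<open>0\<close> times \<open>C\<^sub>r\<^sub>j\<^sub>k G\<^sup>r\<close>.\<close>
  have spray_zero: "cartan_spray j k x = 0" if x: "x \<in> S" for j k x
  proof -
    have 1: "(\<Sum>h\<in>UNIV. snd x $ h * (\<Sum>r\<in>UNIV. a r h * b r)) = (\<Sum>r\<in>UNIV. (\<Sum>h\<in>UNIV. snd x $ h * a r h) * b r)"
      for a :: "'n \<Rightarrow> 'n \<Rightarrow> real" and b
      unfolding sum_distrib_left sum_distrib_right mult.assoc by (rule sum.swap)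
    have contr_X: "(\<Sum>h\<in>UNIV. snd x $ h * cartan1_spray j k h x) = - cartan_spray j k x"
    proof -
      have "(\<Sum>h\<in>UNIV. snd x $ h * cartan1 f r j k h x) = - cartan f r j k x" for r
        using contract_cartan1[OF x, of r j k] by (simp only: cartan1_rotate[OF x, of _ r j k])
      then show ?thesis unfolding cartan1_spray_def 1 cartan_spray_def by (simp add: sum_negf)
    qed
    have cY1: "(\<Sum>h\<in>UNIV. snd x $ h * cartan_spray1 j k h x) = 2 * cartan_spray j k x"
    proof -
      have "(\<Sum>h\<in>UNIV. snd x $ h * spray1 f r h x) = 2 * spray f r x" for r
        using homogeneous_spray[of r] x by (simp add: homogeneous_def spray1_def)
      then show ?thesis
        unfolding cartan_spray1_def cartan_spray_def using 1[of "\<lambda>r h. spray1 f r h x" "\<lambda>r. cartan f r j k x"]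
        by (simp add: mult.commute[of "cartan _ _ _ _ _"] sum_distrib_left mult.assoc)
    qed
    have cY2: "(\<Sum>h\<in>UNIV. snd x $ h * cartan_spray1 k h j x) = 0"
      unfolding cartan_spray1_def 1 contract_cartan[OF x] by simp
    have cY3: "(\<Sum>h\<in>UNIV. snd x $ h * cartan_spray1 h j k x) = 0"
    proof -
      have "(\<Sum>h\<in>UNIV. snd x $ h * cartan f r h j x) = 0" for r
        using contract_cartan[OF x, of j r] by (simp only: cartan_rotate[OF x, of j r])
      then show ?thesis unfolding cartan_spray1_def 1 by simp
    qed
    have "0 = (\<Sum>h\<in>UNIV. snd x $ h * (cartan1_spray j k h x + (cartan_spray1 j k h x + cartan_spray1 k h j x + cartan_spray1 h j k x)))"
      using cond[OF x] by (simp add: cyclic_sum_def)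
    also have "\<dots> = cartan_spray j k x"
      unfolding distrib_left sum.distrib contr_X cY1 cY2 cY3 by simp
    finally show ?thesis by simp
  qed
  \<comment> \<open>Differentiate the vanishing contraction in direction \<open>y\<^sup>h\<close>.\<close>
  have sum_zero: "cartan1_spray j k h z + cartan_spray1 j k h z = 0" for j k h
  proof -
    have "0 = dy h (cartan_spray j k) z"
      using dy_cong[OF z, of "cartan_spray j k" "\<lambda>_. 0"] spray_zero by (simp add: dy_eq_dirder dirder_const)
    also have "\<dots> = (\<Sum>r\<in>UNIV. dy h (\<lambda>z. cartan f r j k z * spray f r z) z)"
      unfolding cartan_spray_def[abs_def] dy_eq_dirder
      by (intro dirder_sum[OF _ z] smooth_on_mult S smooth_cartan smooth_spray)
    also have "\<dots> = cartan1_spray j k h z + cartan_spray1 j k h z"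
      unfolding dy_eq_dirder dirder_mult[OF smooth_cartan smooth_spray z]
      by (simp add: cartan1_spray_def cartan_spray1_def cartan1_def spray1_def dy_eq_dirder sum.distrib)
    finally show ?thesis by simp
  qed
  have "cartan1_spray j k h z + cartan1_spray k h j z + cartan1_spray h j k z + cyclic_sum (\<lambda>j k h. cartan_spray1 j k h z) j k h = 0"
    using sum_zero[of j k h] sum_zero[of k h j] sum_zero[of h j k] by (simp add: cyclic_sum_def)
  moreover have "cartan1_spray k h j z = cartan1_spray j k h z" "cartan1_spray h j k z = cartan1_spray j k h z"
    using cartan1_spray_cycle[OF z, of k h j] cartan1_spray_cycle[OF z, of j k h] by simp_all
  ultimately show "cartan1_spray j k h z = 0" "cyclic_sum (\<lambda>j k h. cartan_spray1 j k h z) j k h = 0"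
    using cond[OF z, of j k h] by linarith+
qed

text \<open>If \<open>H\<^sub>i\<close> is a \<open>y\<close>-gradient, then \<open>H\<^sub>i\<^sub>j\<^sub>k\<^sub>h\<close> is a fourth derivative of the potential, and its
contraction with \<open>y\<^sup>i\<close> is the Euler operator applied to a function of degree \<open>3 - 3 = 0\<close>.\<close>

lemma Lcov_zero_if_Hcov_gradient:
  assumes T: "smooth_on S T" "homogeneous 3 S T"
    and H: "\<And>i z. z \<in> S \<Longrightarrow> Hcov f i z = dy i T z" and z: "z \<in> S"
  shows "Lcov f j k h z = 0"
proof -
  have 1: "dy j (Hcov f i) x = dy i (dy j T) x" if x: "x \<in> S" for i x
    using dy_cong[OF x H] dy_commute[OF T(1) x] by simp
  have 2: "dy k (dy j (Hcov f i)) x = dy i (dy k (dy j T)) x" if x: "x \<in> S" for i x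
    using dy_cong[OF x 1] dy_commute[OF smooth_on_dy[OF T(1)] x] by simp
  have 3: "dy h (dy k (dy j (Hcov f i))) z = dy i (dy h (dy k (dy j T))) z" for i
    using dy_cong[OF z 2] dy_commute[OF smooth_on_dy[OF smooth_on_dy[OF T(1)]] z] by simp
  have "homogeneous (3 - 1 - 1 - 1) S (dy h (dy k (dy j T)))"
    by (intro homogeneous_dy S smooth_on_dy T)
  then show ?thesis
    using z by (simp add: Lcov_def Hcov3_def Hcov2_def Hcov1_def 3 homogeneous_def)
qed

end

section \<open>From the manifold to its charts\<close>

lemma is_chart_inj_on: "is_chart M c \<Longrightarrow> inj_on (map_of_chart c) (dom_of c)"
  unfolding is_chart_def
  using homeomorphic_imp_injective_map openin_subset
  by (metis topspace_subtopology_subset)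

lemma is_chart_open_image:
  assumes "is_chart M c" "openin M U" "U \<subseteq> dom_of c"
  shows "open (map_of_chart c ` U)"
proof -
  have "openin (subtopology M (dom_of c)) U"
    using assms(2,3) by (metis inf.absorb_iff1 openin_subtopology)
  moreover have "open_map (subtopology M (dom_of c)) (top_of_set (map_of_chart c ` dom_of c)) (map_of_chart c)"
    using assms(1) homeomorphic_imp_open_map unfolding is_chart_def by blast
  ultimately have "openin (top_of_set (map_of_chart c ` dom_of c)) (map_of_chart c ` U)"
    unfolding open_map_def by blast
  then show ?thesis
    using assms(1) openin_open_eq unfolding is_chart_def by blast
qed

lemma transition_apply:
  "inj_on (map_of_chart c) (dom_of c) \<Longrightarrow> p \<in> dom_of c \<Longrightarrow>
    transition c d (map_of_chart c p) = map_of_chart d p"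
  by (simp add: transition_def)

lemma transition_has_derivative:
  assumes "smooth_manifold M \<A>" "c \<in> \<A>" "d \<in> \<A>" "p \<in> dom_of c \<inter> dom_of d"
  shows "(transition c d has_derivative frechet_derivative (transition c d) (at (map_of_chart c p)))
    (at (map_of_chart c p))"
proof -
  have "smooth_on (map_of_chart c ` (dom_of c \<inter> dom_of d)) (transition c d)"
    using assms unfolding smooth_manifold_def by blast
  from smooth_on_has_derivative[OF this] show ?thesis
    using assms(4) unfolding dirder_def by blast
qed

text \<open>The chain rule for the coordinate changes between three charts around \<open>p\<close>.\<close>

lemma transition_derivative_cocycle:
  assumes M: "smooth_manifold M \<A>" and cde: "c \<in> \<A>" "d \<in> \<A>" "e \<in> \<A>"
    and p: "p \<in> dom_of c" "p \<in> dom_of d" "p \<in> dom_of e"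
  shows "frechet_derivative (transition c e) (at (map_of_chart c p)) y =
    frechet_derivative (transition d e) (at (map_of_chart d p))
      (frechet_derivative (transition c d) (at (map_of_chart c p)) y)"
proof -
  let ?U = "dom_of c \<inter> dom_of d \<inter> dom_of e" and ?x = "map_of_chart c p"
  have charts: "is_chart M c" "is_chart M d" "is_chart M e"
    using M cde unfolding smooth_manifold_def by auto
  note inj = charts[THEN is_chart_inj_on]
  have "(transition d e \<circ> transition c d has_derivative
      frechet_derivative (transition d e) (at (map_of_chart d p)) \<circ> frechet_derivative (transition c d) (at ?x)) (at ?x)"
    using transition_has_derivative[OF M] cde p transition_apply[OF inj(1) p(1)]
    by (intro diff_chain_at) auto
  moreover have "open (map_of_chart c ` ?U)"
    using charts by (intro is_chart_open_image[OF charts(1)] openin_Int) (auto simp: is_chart_def)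
  moreover have "?x \<in> map_of_chart c ` ?U" using p by blast
  moreover have "(transition d e \<circ> transition c d) x = transition c e x" if "x \<in> map_of_chart c ` ?U" for x
    using that by (auto simp: transition_apply inj)
  ultimately have "(transition c e has_derivative
      frechet_derivative (transition d e) (at (map_of_chart d p)) \<circ> frechet_derivative (transition c d) (at ?x)) (at ?x)"
    by (rule has_derivative_transform_within_open)
  from frechet_derivative_at[OF this, symmetric] show ?thesis by simp
qed

lemma transition_self_derivative:
  assumes "is_chart M c" "p \<in> dom_of c"
  shows "frechet_derivative (transition c c) (at (map_of_chart c p)) y = y"
proof -
  have "(transition c c has_derivative (\<lambda>v. v)) (at (map_of_chart c p))"
  proof (rule has_derivative_transform_within_open[OF has_derivative_ident])
    show "open (map_of_chart c ` dom_of c)" using assms(1) by (simp add: is_chart_def)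
    show "x = transition c c x" if "x \<in> map_of_chart c ` dom_of c" for x
      using that by (auto simp: transition_apply[OF is_chart_inj_on[OF assms(1)]])
  qed (use assms(2) in simp)
  from frechet_derivative_at[OF this, symmetric] show ?thesis by simp
qed

definition vector_of_components ::
    "('m, 'n::finite) chart set \<Rightarrow> ('m, 'n) chart \<Rightarrow> 'm \<Rightarrow> real ^ 'n \<Rightarrow> ('m, 'n) chart \<Rightarrow> real ^ 'n" where
  "vector_of_components \<A> c p y d = (if d \<in> \<A> \<and> p \<in> dom_of d
     then frechet_derivative (transition c d) (at (map_of_chart c p)) y else 0)"

lemma vector_of_components:
  assumes M: "smooth_manifold M \<A>" and c: "c \<in> \<A>" and p: "p \<in> dom_of c"
  shows "vector_of_components \<A> c p y \<in> tangent_space \<A> p"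
    and "vector_of_components \<A> c p y c = y"
proof -
  show "vector_of_components \<A> c p y \<in> tangent_space \<A> p"
    unfolding tangent_space_def
  proof (intro CollectI conjI allI impI ballI)
    fix d assume "\<not> (d \<in> \<A> \<and> p \<in> dom_of d)"
    then show "vector_of_components \<A> c p y d = 0"
      by (simp only: vector_of_components_def if_False)
  next
    fix d e assume d: "d \<in> \<A>" and e: "e \<in> \<A>" and "p \<in> dom_of d \<inter> dom_of e"
    then have "p \<in> dom_of d" "p \<in> dom_of e" by auto
    with transition_derivative_cocycle[OF M c d e p this, of y] d e
    show "vector_of_components \<A> c p y e
        = frechet_derivative (transition d e) (at (map_of_chart d p)) (vector_of_components \<A> c p y d)"
      by (simp add: vector_of_components_def)
  qed
  have "is_chart M c" using M c by (auto simp: smooth_manifold_def)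
  then show "vector_of_components \<A> c p y c = y"
    using c p transition_self_derivative[of M c p y] by (simp add: vector_of_components_def)
qed

text \<open>A tangent vector is determined by its components in one chart, so the inverse of the induced
coordinates in \<^const>\<open>in_coords\<close> returns the vector one starts from.\<close>

lemma in_coords_induced_coords:
  assumes M: "smooth_manifold M \<A>" and c: "c \<in> \<A>" and p: "p \<in> dom_of c" and v: "v \<in> tangent_space \<A> p"
  shows "in_coords \<A> c F (map_of_chart c p, v c) = F (p, v)"
proof -
  have "is_chart M c" using M c by (simp add: smooth_manifold_def)
  then have inj: "inj_on (map_of_chart c) (dom_of c)" by (rule is_chart_inj_on)
  have eq: "v = w" if "q \<in> dom_of c" "v \<in> tangent_space \<A> q" "w \<in> tangent_space \<A> q" "v c = w c"
    for q v w
  proof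
    fix d
    have "u d = (if d \<in> \<A> \<and> q \<in> dom_of d
        then frechet_derivative (transition c d) (at (map_of_chart c q)) (u c) else 0)"
      if "u \<in> tangent_space \<A> q" for u
      using that \<open>q \<in> dom_of c\<close> c unfolding tangent_space_def by (simp only: mem_Collect_eq split: if_split) blast
    from this[OF that(2)] this[OF that(3)] show "v d = w d"
      by (simp only: that(4))
  qed
  have "inj_on (induced_coords c) (tangent_bundle \<A> (dom_of c))"
  proof (rule inj_onI)
    fix u w assume u: "u \<in> tangent_bundle \<A> (dom_of c)" and w: "w \<in> tangent_bundle \<A> (dom_of c)"
      and uw: "induced_coords c u = induced_coords c w"
    have base: "fst u = fst w"
      using u w uw by (intro inj_onD[OF inj]) (auto simp: tangent_bundle_def induced_coords_def)
    have "snd u = snd w"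
      using u w uw base
      by (intro eq[of "fst u"]) (auto simp: tangent_bundle_def induced_coords_def)
    with base show "u = w" by (rule prod_eqI)
  qed
  moreover have "(p, v) \<in> tangent_bundle \<A> (dom_of c)" using p v by (simp add: tangent_bundle_def)
  ultimately have "in_coords \<A> c F (induced_coords c (p, v)) = F (p, v)"
    unfolding in_coords_def by simp
  then show ?thesis by (simp add: induced_coords_def)
qed

lemma tangent_space_scaleR:
  assumes "smooth_manifold M \<A>" "v \<in> tangent_space \<A> p"
  shows "(\<lambda>c. t *\<^sub>R v c) \<in> tangent_space \<A> p"
proof -
  have "t *\<^sub>R v d = frechet_derivative (transition c d) (at (map_of_chart c p)) (t *\<^sub>R v c)"
    if "c \<in> \<A>" "d \<in> \<A>" "p \<in> dom_of c \<inter> dom_of d" for c d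
  proof -
    have "v d = frechet_derivative (transition c d) (at (map_of_chart c p)) (v c)"
      using assms(2) that unfolding tangent_space_def by blast
    then show ?thesis
      using linear_scale[OF has_derivative_linear[OF transition_has_derivative[OF assms(1) that]]]
      by simp
  qed
  moreover have "t *\<^sub>R v c = 0" if "\<not> (c \<in> \<A> \<and> p \<in> dom_of c)" for c
  proof -
    have "v c = 0" using assms(2) that unfolding tangent_space_def by blast
    then show ?thesis by simp
  qed
  ultimately show ?thesis
    unfolding tangent_space_def by blast
qed

lemma open_slit_coords: "is_chart M c \<Longrightarrow> open (slit_coords c)"
  unfolding slit_coords_def is_chart_def by (intro open_Times open_Diff) auto

text \<open>Only homogeneity needs an argument: scaling the fibre coordinate corresponds to scaling the tangent
vector with these coordinates, which exists by \<open>vector_of_components\<close>.\<close>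

lemma local_finsler_in_coords:
  fixes \<A> :: "('m, 'n::finite) chart set"
  assumes F: "finsler_manifold M \<A> F" and c: "c \<in> \<A>"
  shows "local_finsler (in_coords \<A> c F) (slit_coords c)"
proof
  have M: "smooth_manifold M \<A>" using F by (simp add: finsler_manifold_def)
  then have chart: "is_chart M c" using c by (auto simp: smooth_manifold_def)
  show op: "open (slit_coords c)" by (rule open_slit_coords[OF chart])
  show sm: "smooth_on (slit_coords c) (in_coords \<A> c F)"
    using F c by (simp add: finsler_manifold_def)
  show "invertible (metric_matrix (in_coords \<A> c F) z)" if "z \<in> slit_coords c" for z
    using F c that by (simp add: finsler_manifold_def)
  show "homogeneous 1 (slit_coords c) (in_coords \<A> c F)"
  proof (rule homogeneous_of_scaling[OF op sm])
    fix x y :: "real ^ 'n" and t :: real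
    assume xy: "(x, y) \<in> slit_coords c" and t: "t > 0"
    then obtain p where p: "p \<in> dom_of c" "x = map_of_chart c p"
      by (auto simp: slit_coords_def)
    define v where "v = vector_of_components \<A> c p y"
    have v: "v \<in> tangent_space \<A> p" "v c = y"
      using vector_of_components[OF M c p(1)] by (simp_all add: v_def)
    have "p \<in> topspace M" using p(1) chart openin_subset by (auto simp: is_chart_def)
    then have "F (p, \<lambda>c. t *\<^sub>R v c) = t * F (p, v)"
      using F t v(1) unfolding finsler_manifold_def tangent_bundle_def by auto
    then show "in_coords \<A> c F (x, t *\<^sub>R y) = t * in_coords \<A> c F (x, y)"
      using in_coords_induced_coords[OF M c p(1) v(1)]
        in_coords_induced_coords[OF M c p(1) tangent_space_scaleR[OF M v(1), of t]]
      by (simp add: p(2) v(2))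
  qed
qed

lemma H_Berwald_imp_H_Landsberg: "H_Berwald \<A> F \<Longrightarrow> H_Landsberg \<A> F"
  unfolding H_Berwald_def H_Landsberg_def by (simp add: Lcov_def)

lemma H_Berwald_iff_Berwald:
  assumes "finsler_manifold M \<A> F" "Berwald_condition \<A> F"
  shows "H_Berwald \<A> F \<longleftrightarrow> Berwald \<A> F"
proof -
  have "(\<forall>i j k h. Hcov3 (in_coords \<A> c F) i j k h z = 0) \<longleftrightarrow>
      (\<forall>r j k h. spray3 (in_coords \<A> c F) r j k h z = 0)"
    if c: "c \<in> \<A>" and z: "z \<in> slit_coords c" for c z
  proof -
    interpret local_finsler "in_coords \<A> c F" "slit_coords c"
      by (rule local_finsler_in_coords[OF assms(1) c])
    have "berwald_term i j k h z = 0" for i j k h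
      using assms(2) c z unfolding Berwald_condition_def Let_def berwald_term_def by blast
    then show ?thesis using Hcov3_zero_iff[OF z] by blast
  qed
  then show ?thesis unfolding H_Berwald_def Berwald_def by blast
qed

lemma H_Landsberg_iff_Landsberg:
  assumes "finsler_manifold M \<A> F" "Landsberg_condition \<A> F"
  shows "H_Landsberg \<A> F \<longleftrightarrow> Landsberg \<A> F"
proof -
  have "Lcov (in_coords \<A> c F) j k h z =
     (\<Sum>i\<in>UNIV. \<Sum>r\<in>UNIV. snd z $ i * metric (in_coords \<A> c F) i r z *
        spray3 (in_coords \<A> c F) r j k h z)"
    if c: "c \<in> \<A>" and z: "z \<in> slit_coords c" for c z j k h
  proof -
    interpret local_finsler "in_coords \<A> c F" "slit_coords c"
      by (rule local_finsler_in_coords[OF assms(1) c])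
    have "cartan1_spray j k h z + cyclic_sum (\<lambda>j k h. cartan_spray1 j k h z) j k h = 0" if "z \<in> slit_coords c" for z j k h
      using assms(2) c that unfolding Landsberg_condition_def Let_def cartan1_spray_def cartan_spray1_def by blast
    from landsberg_condition_splits[OF this z] show ?thesis
      unfolding Lcov_eq[OF z] by simp
  qed
  then show ?thesis unfolding H_Landsberg_def Landsberg_def by simp
qed

section \<open>An H-Landsberg metric that is not H-Berwald\<close>

definition ex_dom :: "(real ^ 2) set" where
  "ex_dom = ball 0 (1/4)"

definition ex_chart :: "(real ^ 2, 2) chart" where
  "ex_chart = (ex_dom, id)"

text \<open>The square of the metric.  It is affine in \<open>x\<close> with linear part \<open>2 |y| (x \<bullet> y)\<close>; this
makes \<open>H\<^sub>i\<close> independent of \<open>x\<close> and proportional to \<open>|y| y\<^sub>i\<close>.  The radius \<open>1/4\<close> of the disc keeps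
the square positive and the fundamental tensor non-degenerate.\<close>

definition ex_energy :: "2 field" where
  "ex_energy z = norm (snd z) * norm (snd z) + 2 * (norm (snd z) * (fst z \<bullet> snd z))"

definition ex_F :: "(real ^ 2) \<times> ((real ^ 2, 2) chart \<Rightarrow> real ^ 2) \<Rightarrow> real" where
  "ex_F u = sqrt (ex_energy (fst u, snd u ex_chart))"

abbreviation "ynorm \<equiv> \<lambda>z :: (real ^ 'n::finite) \<times> (real ^ 'n). norm (snd z)"

abbreviation "xdoty \<equiv> \<lambda>z :: (real ^ 'n::finite) \<times> (real ^ 'n). fst z \<bullet> snd z"

lemma smooth_on_xdoty: "open S \<Longrightarrow> smooth_on S (xdoty :: 'n::finite field)"
  unfolding inner_vec_def inner_real_def
  by (intro smooth_on_sum smooth_on_mult smooth_on_y smooth_on_bounded_linear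
      bounded_linear_compose[OF bounded_linear_vec_nth bounded_linear_fst])

lemma smooth_on_ynorm:
  assumes "open S" "\<And>z. z \<in> S \<Longrightarrow> snd z \<noteq> 0"
  shows "smooth_on S (ynorm :: 'n::finite field)"
proof -
  have "smooth_on S (\<lambda>z. sqrt (snd z \<bullet> snd z))"
  proof (rule smooth_on_sqrt[OF assms(1)])
    show "smooth_on S (\<lambda>z. snd z \<bullet> snd z)"
      unfolding inner_vec_def inner_real_def
      by (intro smooth_on_sum smooth_on_mult smooth_on_y assms(1))
  qed (use assms(2) in auto)
  then show ?thesis by (simp add: norm_eq_sqrt_inner)
qed

lemma dirder_ynorm:
  "snd z \<noteq> 0 \<Longrightarrow> dirder v ynorm z = (snd z \<bullet> snd v) * inverse (norm (snd z))"
  unfolding norm_eq_sqrt_inner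
  by (rule dirder_eq) (auto intro!: derivative_eq_intros simp: inner_commute)

lemma dirder_xdoty: "dirder v xdoty z = fst z \<bullet> snd v + fst v \<bullet> snd z"
  by (rule dirder_eq) (auto intro!: derivative_eq_intros)

lemma homogeneous_ynorm:
  assumes "\<And>z. z \<in> S \<Longrightarrow> snd z \<noteq> 0"
  shows "homogeneous 1 S (ynorm :: 'n::finite field)"
  unfolding homogeneous_def dy_eq_dirder
proof
  fix z assume "z \<in> S"
  then have z: "snd z \<noteq> 0" using assms by blast
  have "(\<Sum>i\<in>UNIV. snd z $ i * dirder (0, axis i 1) ynorm z)
      = (snd z \<bullet> snd z) * inverse (norm (snd z))"
    unfolding dirder_ynorm[OF z]
    unfolding inner_vec_def[of "snd z" "snd z"]
    by (simp add: inner_axis sum_distrib_right mult.assoc)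
  also have "\<dots> = 1 * norm (snd z)"
    using z by (simp add: dot_square_norm power2_eq_square)
  finally show "(\<Sum>i\<in>UNIV. snd z $ i * dirder (0, axis i 1) ynorm z) = 1 * norm (snd z)" .
qed

abbreviation "ex_slit \<equiv> ex_dom \<times> (UNIV - {0}) :: ((real ^ 2) \<times> (real ^ 2)) set"

lemma open_ex_slit: "open ex_slit"
  unfolding ex_dom_def by (intro open_Times open_Diff) auto

lemma slit_coords_ex_chart: "slit_coords ex_chart = ex_slit"
  by (simp add: slit_coords_def ex_chart_def)

lemma ex_slit_nonzero: "z \<in> ex_slit \<Longrightarrow> snd z \<noteq> 0"
  by auto

lemma smooth_ynorm_ex: "smooth_on ex_slit ynorm"
  by (rule smooth_on_ynorm[OF open_ex_slit ex_slit_nonzero])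

lemmas smooth_xdoty_ex = smooth_on_xdoty[OF open_ex_slit]
lemmas smooth_y_ex = smooth_on_y[OF open_ex_slit]
lemmas smooth_ex = smooth_on_mult[OF open_ex_slit] smooth_on_add[OF open_ex_slit]
  smooth_ynorm_ex smooth_xdoty_ex smooth_y_ex smooth_on_const

lemma smooth_x_ex: "smooth_on ex_slit (\<lambda>z. fst z $ i)"
  by (intro smooth_on_bounded_linear open_ex_slit
      bounded_linear_compose[OF bounded_linear_vec_nth bounded_linear_fst])

lemma smooth_inverse_ynorm_ex: "smooth_on ex_slit (\<lambda>z. inverse (norm (snd z)))"
  by (intro smooth_on_inverse open_ex_slit smooth_ynorm_ex) auto

lemma dirder_x: "dirder v (\<lambda>z :: (real ^ 'n::finite) \<times> (real ^ 'n). fst z $ i) z = fst v $ i"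
  using dirder_eq[OF bounded_linear.has_derivative[OF bounded_linear_compose[OF bounded_linear_vec_nth bounded_linear_fst] has_derivative_ident]] .

lemma dirder_inverse_ynorm:
  fixes z :: "(real ^ 'n::finite) \<times> (real ^ 'n)"
  assumes "snd z \<noteq> 0"
  shows "dirder v (\<lambda>z. inverse (norm (snd z))) z = - (snd z \<bullet> snd v) * inverse (norm (snd z)) ^ 3"
proof (rule dirder_eq)
  have "(ynorm has_derivative (\<lambda>v. (snd z \<bullet> snd v) * inverse (norm (snd z)))) (at z)"
    unfolding norm_eq_sqrt_inner using assms
    by (auto intro!: derivative_eq_intros simp: inner_commute)
  from Deriv.has_derivative_inverse[OF _ this] show
    "((\<lambda>z. inverse (norm (snd z))) has_derivative
      (\<lambda>v. - (snd z \<bullet> snd v) * inverse (norm (snd z)) ^ 3)) (at z)"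
    using assms by (simp add: power3_eq_cube mult_ac)
qed

lemma ex_energy_eq: "ex_energy = (\<lambda>z. ynorm z * ynorm z + 2 * (ynorm z * xdoty z))"
  by (simp add: fun_eq_iff ex_energy_def)

lemma dirder_ex_energy:
  assumes z: "z \<in> ex_slit"
  shows "dirder v ex_energy z = 2 * (snd z \<bullet> snd v)
     + 2 * (ynorm z * (fst z \<bullet> snd v + fst v \<bullet> snd z))
     + 2 * (xdoty z * ((snd z \<bullet> snd v) * inverse (ynorm z)))"
proof -
  have "dirder v ex_energy z = dirder v (\<lambda>z. ynorm z * ynorm z) z + dirder v (\<lambda>z. 2 * (ynorm z * xdoty z)) z"
    unfolding ex_energy_eq by (intro dirder_add[OF _ _ z] smooth_ex)
  also have "dirder v (\<lambda>z. ynorm z * ynorm z) z = 2 * (snd z \<bullet> snd v)"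
    unfolding dirder_mult[OF smooth_ynorm_ex smooth_ynorm_ex z] dirder_ynorm[OF ex_slit_nonzero[OF z]]
    using ex_slit_nonzero[OF z] by simp
  also have "dirder v (\<lambda>z. 2 * (ynorm z * xdoty z)) z = 2 * dirder v (\<lambda>z. ynorm z * xdoty z) z"
    by (intro dirder_cmult[OF _ z] smooth_ex)
  also have "dirder v (\<lambda>z. ynorm z * xdoty z) z
      = ynorm z * (fst z \<bullet> snd v + fst v \<bullet> snd z) + (snd z \<bullet> snd v) * inverse (ynorm z) * xdoty z"
    unfolding dirder_mult[OF smooth_ynorm_ex smooth_xdoty_ex z] dirder_ynorm[OF ex_slit_nonzero[OF z]] dirder_xdoty by simp
  finally show ?thesis by (simp add: algebra_simps)
qed

lemma dx_ex_energy: "z \<in> ex_slit \<Longrightarrow> dx i ex_energy z = 2 * (ynorm z * snd z $ i)"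
  by (simp add: dx_eq_dirder dirder_ex_energy inner_axis')

lemma dy_ex_energy:
  "z \<in> ex_slit \<Longrightarrow> dy i ex_energy z =
    2 * (snd z $ i + ynorm z * fst z $ i + xdoty z * (snd z $ i * inverse (ynorm z)))"
  by (simp add: dy_eq_dirder dirder_ex_energy inner_axis)

lemma dirder_dy_ex_energy:
  assumes z: "z \<in> ex_slit"
  shows "dirder v (dy i ex_energy) z = 2 * (snd v $ i
     + (ynorm z * fst v $ i + (snd z \<bullet> snd v) * inverse (ynorm z) * fst z $ i)
     + (xdoty z * (snd v $ i * inverse (ynorm z) - snd z $ i * ((snd z \<bullet> snd v) * inverse (ynorm z) ^ 3))
       + (fst z \<bullet> snd v + fst v \<bullet> snd z) * (snd z $ i * inverse (ynorm z))))"
proof -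
  note sm = smooth_ex smooth_x_ex smooth_inverse_ynorm_ex
  have "dirder v (dy i ex_energy) z
      = dirder v (\<lambda>z. 2 * (snd z $ i + ynorm z * fst z $ i + xdoty z * (snd z $ i * inverse (ynorm z)))) z"
    by (rule dirder_cong[OF open_ex_slit z dy_ex_energy])
  also have "\<dots> = 2 * dirder v (\<lambda>z. snd z $ i + ynorm z * fst z $ i + xdoty z * (snd z $ i * inverse (ynorm z))) z"
    by (intro dirder_cmult[OF _ z] sm)
  also have "dirder v (\<lambda>z. snd z $ i + ynorm z * fst z $ i + xdoty z * (snd z $ i * inverse (ynorm z))) z
      = dirder v (\<lambda>z. snd z $ i + ynorm z * fst z $ i) z + dirder v (\<lambda>z. xdoty z * (snd z $ i * inverse (ynorm z))) z"
    by (intro dirder_add[OF _ _ z] sm)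
  also have "dirder v (\<lambda>z. snd z $ i + ynorm z * fst z $ i) z
      = snd v $ i + dirder v (\<lambda>z. ynorm z * fst z $ i) z"
    by (subst dirder_add[OF _ _ z]) (intro sm dirder_y | simp add: dirder_y)+
  also have "dirder v (\<lambda>z. ynorm z * fst z $ i) z
      = ynorm z * fst v $ i + (snd z \<bullet> snd v) * inverse (ynorm z) * fst z $ i"
    unfolding dirder_mult[OF smooth_ynorm_ex smooth_x_ex z] dirder_ynorm[OF ex_slit_nonzero[OF z]] dirder_x ..
  also have "dirder v (\<lambda>z. xdoty z * (snd z $ i * inverse (ynorm z))) z
      = xdoty z * dirder v (\<lambda>z. snd z $ i * inverse (ynorm z)) z + dirder v xdoty z * (snd z $ i * inverse (ynorm z))"
    by (intro dirder_mult[OF _ _ z] sm)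
  also have "dirder v (\<lambda>z. snd z $ i * inverse (ynorm z)) z
      = snd v $ i * inverse (ynorm z) - snd z $ i * ((snd z \<bullet> snd v) * inverse (ynorm z) ^ 3)"
    unfolding dirder_mult[OF smooth_y_ex smooth_inverse_ynorm_ex z] dirder_inverse_ynorm[OF ex_slit_nonzero[OF z]] dirder_y by simp
  also have "dirder v xdoty z = fst z \<bullet> snd v + fst v \<bullet> snd z" by (rule dirder_xdoty)
  finally show ?thesis .
qed

lemma ex_energy_pos: "z \<in> ex_slit \<Longrightarrow> ex_energy z > 0"
proof -
  assume z: "z \<in> ex_slit"
  have ynorm: "ynorm z > 0" using ex_slit_nonzero[OF z] by simp
  have "\<bar>xdoty z\<bar> \<le> norm (fst z) * ynorm z" by (rule Cauchy_Schwarz_ineq2)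
  also have "\<dots> \<le> 1/4 * ynorm z"
    using z by (intro mult_right_mono) (auto simp: ex_dom_def)
  finally have "ynorm z + 2 * xdoty z > 0" using ynorm by linarith
  then have "ynorm z * (ynorm z + 2 * xdoty z) > 0" using ynorm by simp
  then show ?thesis by (simp add: ex_energy_def algebra_simps)
qed

lemma smooth_ex_energy: "smooth_on ex_slit ex_energy"
  unfolding ex_energy_eq by (intro smooth_ex)

text \<open>The determinant of the fundamental tensor at \<open>(x, y)\<close>, where \<open>(a, b)\<close> is the unit vector along the
fibre coordinate.  The right-hand side is the same determinant in the orthonormal frame that
contains this unit vector; \<open>p\<close> and \<open>x * b - y * a\<close> are the components of the base point there.\<close>

lemma fundamental_tensor_det_identity:
  fixes a b x y :: real
  assumes "a\<^sup>2 + b\<^sup>2 = 1" "p = x * a + y * b"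
  shows "(1 + 2 * x * a + p - p * a\<^sup>2) * (1 + 2 * y * b + p - p * b\<^sup>2) - (y * a + x * b - p * a * b)\<^sup>2
    = (1 + 2 * p) * (1 + p) - (x * b - y * a)\<^sup>2"
  using assms by algebra

text \<open>In the frame of the previous lemma the two components of the base point have squares that add up to
less than \<open>1/16\<close>, which leaves the diagonal product above \<open>1/4\<close> and the squared off-diagonal
entry below \<open>1/16\<close>.\<close>

lemma det_positive:
  fixes a b x y :: real
  assumes ab: "a\<^sup>2 + b\<^sup>2 = 1" and xy: "x\<^sup>2 + y\<^sup>2 < (1/4)\<^sup>2" and p: "p = x * a + y * b"
  shows "(1 + 2 * x * a + p - p * a\<^sup>2) * (1 + 2 * y * b + p - p * b\<^sup>2) - (y * a + x * b - p * a * b)\<^sup>2 > 0"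
proof -
  define q where "q = x * b - y * a"
  have "p\<^sup>2 + q\<^sup>2 = (x\<^sup>2 + y\<^sup>2) * (a\<^sup>2 + b\<^sup>2)"
    by (simp add: p q_def power2_eq_square algebra_simps)
  then have pq: "p\<^sup>2 + q\<^sup>2 < (1/4)\<^sup>2" using ab xy by simp
  then have "p\<^sup>2 < (1/4)\<^sup>2" using zero_le_power2[of q] by linarith
  then have "\<bar>p\<bar> < 1/4" using power2_less_imp_less[of "\<bar>p\<bar>" "1/4"] by simp
  moreover have "(1/4 :: real)\<^sup>2 = 1/16" by (simp add: power2_eq_square)
  then have "q\<^sup>2 < 1/16" using pq zero_le_power2[of p] by linarith
  moreover have "(1 + 2 * p) * (1 + p) = 1 + 3 * p + 2 * p\<^sup>2" by (simp add: power2_eq_square algebra_simps)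
  ultimately show ?thesis
    unfolding fundamental_tensor_det_identity[OF ab p] q_def[symmetric]
    using zero_le_power2[of p] by linarith
qed

lemma metric_matrix_ex_invertible:
  assumes f: "\<And>z. z \<in> ex_slit \<Longrightarrow> f z = sqrt (ex_energy z)" and z: "z \<in> ex_slit"
  shows "invertible (metric_matrix f z)"
proof -
  have sq: "sq f z = ex_energy z" if "z \<in> ex_slit" for z
    using f[OF that] ex_energy_pos[OF that] by (simp add: sq_def)
  have "dy j (sq f) w = dy j ex_energy w" if "w \<in> ex_slit" for j w
    unfolding dy_eq_dirder by (rule dirder_cong[OF open_ex_slit that sq])
  then have g: "metric f i j z = 1/2 * dirder (0, axis i 1) (dy j ex_energy) z" for i j
    unfolding metric_def dy_eq_dirder[of i] using dirder_cong[OF open_ex_slit z] by metis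
  define a b x y where "a = snd z $ 1 * inverse (ynorm z)" and "b = snd z $ 2 * inverse (ynorm z)"
    and "x = fst z $ 1" and "y = fst z $ 2"
  define p where "p = x * a + y * b"
  have ynorm: "ynorm z \<noteq> 0" using ex_slit_nonzero[OF z] by simp
  have NN: "(snd z $ 1)\<^sup>2 + (snd z $ 2)\<^sup>2 = (ynorm z)\<^sup>2"
    by (simp add: norm_vec_def L2_set_def sum_2 sum_nonneg)
  have ab: "a\<^sup>2 + b\<^sup>2 = 1"
    using ynorm NN by (simp add: a_def b_def power_mult_distrib flip: distrib_right) (simp add: power_inverse)
  have "norm (fst z) < 1/4" using z by (auto simp: ex_dom_def)
  then have "(norm (fst z))\<^sup>2 < (1/4)\<^sup>2" by (intro power_strict_mono) auto
  then have xy: "x\<^sup>2 + y\<^sup>2 < (1/4)\<^sup>2"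
    by (simp add: x_def y_def norm_vec_def L2_set_def sum_2 sum_nonneg)
  have p: "p = xdoty z * inverse (ynorm z)"
    by (simp add: p_def x_def y_def a_def b_def inner_vec_def sum_2 algebra_simps)
  have gij: "metric f i j z = (if i = j then 1 else 0) + snd z $ i * inverse (ynorm z) * fst z $ j
      + p * (if i = j then 1 else 0) - p * (snd z $ i * inverse (ynorm z)) * (snd z $ j * inverse (ynorm z))
      + fst z $ i * (snd z $ j * inverse (ynorm z))" for i j
    unfolding g dirder_dy_ex_energy[OF z] p fst_conv snd_conv inner_axis inner_zero_left
    by (simp add: axis_def power3_eq_cube algebra_simps)
  have m: "metric f 1 1 z = 1 + 2 * x * a + p - p * a\<^sup>2" "metric f 2 2 z = 1 + 2 * y * b + p - p * b\<^sup>2"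
    "metric f 1 2 z = y * a + x * b - p * a * b" "metric f 2 1 z = y * a + x * b - p * a * b"
    unfolding gij a_def b_def x_def y_def by (simp_all add: power2_eq_square algebra_simps)
  have "det (metric_matrix f z) > 0"
    using det_positive[OF ab xy p_def] by (simp add: det_2 metric_matrix_def m power2_eq_square)
  then show ?thesis by (simp add: invertible_det_nz)
qed

definition ex_topology :: "(real ^ 2) topology" where "ex_topology = top_of_set ex_dom"

lemma second_countable_euclidean:
  "second_countable (euclidean :: 'a::second_countable_topology topology)"
proof -
  obtain B :: "'a set set" where B: "countable B" "topological_basis B"
    using ex_countable_basis by blast
  have "\<exists>V\<in>B. x \<in> V \<and> V \<subseteq> U" if "open U" "x \<in> U" for U x
    using topological_basisE[OF B(2) that] by metis
  then show ?thesis
    unfolding second_countable_def using B topological_basis_open[OF B(2)]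
    by (intro exI[of _ B]) simp
qed

lemma open_ex_dom: "open ex_dom"
  by (simp add: ex_dom_def)

lemma smooth_manifold_ex: "smooth_manifold ex_topology {ex_chart}"
proof -
  have "smooth_on ex_dom (transition ex_chart ex_chart)"
    using smooth_on_cong[OF open_ex_dom, of "transition ex_chart ex_chart" "\<lambda>x. x"]
      smooth_on_bounded_linear[OF bounded_linear_ident open_ex_dom]
    by (simp add: transition_def ex_chart_def f_inv_into_f)
  moreover have "is_chart ex_topology ex_chart"
    unfolding is_chart_def ex_topology_def ex_chart_def
    using open_ex_dom by (simp add: subtopology_subtopology)
  ultimately show ?thesis
    unfolding smooth_manifold_def ex_topology_def
    by (auto simp: ex_chart_def Hausdorff_space_subtopology second_countable_subtopology second_countable_euclidean)
qed

abbreviation "ex_f \<equiv> in_coords {ex_chart} ex_chart ex_F"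

lemma ex_f: "z \<in> ex_slit \<Longrightarrow> ex_f z = sqrt (ex_energy z)"
proof -
  assume z: "z \<in> ex_slit"
  let ?v = "vector_of_components {ex_chart} ex_chart (fst z) (snd z)"
  have p: "fst z \<in> dom_of ex_chart" using z by (auto simp: ex_chart_def)
  note v = vector_of_components[OF smooth_manifold_ex singletonI p, of "snd z"]
  have "ex_f (map_of_chart ex_chart (fst z), ?v ex_chart) = ex_F (fst z, ?v)"
    by (rule in_coords_induced_coords[OF smooth_manifold_ex singletonI p v(1)])
  then show ?thesis by (simp add: v(2) ex_F_def) (simp add: ex_chart_def)
qed

lemma ex_energy_scaleR: "ex_energy (x, t *\<^sub>R y) = t\<^sup>2 * ex_energy (x, y)" if "t > 0"
  using that by (simp add: ex_energy_def power2_eq_square algebra_simps)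

lemma finsler_manifold_ex: "finsler_manifold ex_topology {ex_chart} ex_F"
  unfolding finsler_manifold_def
proof (intro conjI smooth_manifold_ex ballI)
  fix u assume u: "u \<in> tangent_bundle {ex_chart} (topspace ex_topology)"
  obtain p v where pv: "u = (p, v)" by force
  then have p: "p \<in> ex_dom" and v: "v \<in> tangent_space {ex_chart} p"
    using u by (auto simp: tangent_bundle_def ex_topology_def)
  have zero: "v = (\<lambda>_. 0) \<longleftrightarrow> v ex_chart = 0"
  proof
    assume "v ex_chart = 0"
    moreover have "v c = 0" if "c \<noteq> ex_chart" for c
      using v that unfolding tangent_space_def by blast
    ultimately have "v c = 0" for c by (cases "c = ex_chart") (simp_all only:)
    then show "v = (\<lambda>_. 0)" by (rule ext)
  qed simp
  have pos: "ex_energy (p, v ex_chart) > 0" if "v ex_chart \<noteq> 0"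
    using that p by (intro ex_energy_pos) auto
  show "case u of (p, v) \<Rightarrow> ex_F (p, v) \<ge> 0 \<and> (ex_F (p, v) = 0 \<longleftrightarrow> v = (\<lambda>_. 0)) \<and>
      (\<forall>t>0. ex_F (p, \<lambda>c. t *\<^sub>R v c) = t * ex_F (p, v))"
    using pos by (cases "v ex_chart = 0")
      (auto simp: pv zero ex_F_def ex_energy_scaleR real_sqrt_mult, auto simp: ex_energy_def)
next
  fix c assume "c \<in> {ex_chart}"
  then have c: "c = ex_chart" by simp
  have "smooth_on ex_slit (\<lambda>z. sqrt (ex_energy z))"
    by (intro smooth_on_sqrt open_ex_slit smooth_ex_energy ex_energy_pos)
  then show "smooth_on (slit_coords c) (in_coords {ex_chart} c ex_F)"
    unfolding c slit_coords_ex_chart by (simp only: smooth_on_cong[OF open_ex_slit ex_f])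
  fix z assume "z \<in> slit_coords c"
  then show "invertible (metric_matrix (in_coords {ex_chart} c ex_F) z)"
    unfolding c slit_coords_ex_chart by (rule metric_matrix_ex_invertible[rotated]) (rule ex_f)
qed

lemma local_finsler_ex: "local_finsler ex_f ex_slit"
  using local_finsler_in_coords[OF finsler_manifold_ex singletonI] by (simp add: slit_coords_ex_chart)

lemma Hcov_ex:
  assumes z: "z \<in> ex_slit"
  shows "Hcov ex_f i z = 1/2 * (ynorm z * snd z $ i)"
proof -
  interpret local_finsler ex_f ex_slit by (rule local_finsler_ex)
  have sq: "sq ex_f z = ex_energy z" if "z \<in> ex_slit" for z
    using ex_f[OF that] ex_energy_pos[OF that] by (simp add: sq_def)
  have dy: "dy j (sq ex_f) w = dy j ex_energy w" if "w \<in> ex_slit" for j w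
    by (rule dy_cong[OF that sq])
  have "dx r (dy i (sq ex_f)) z = 2 * (ynorm z * (if r = i then 1 else 0) + snd z $ r * (snd z $ i * inverse (ynorm z)))" for r
  proof -
    have "dx r (dy i (sq ex_f)) z = dirder (axis r 1, 0) (dy i ex_energy) z"
      unfolding dx_eq_dirder by (rule dirder_cong[OF open_ex_slit z dy])
    then show ?thesis
      unfolding dirder_dy_ex_energy[OF z] fst_conv snd_conv inner_axis' inner_zero_right
      by (simp add: axis_def eq_commute)
  qed
  then have "(\<Sum>r\<in>UNIV. snd z $ r * dx r (dy i (sq ex_f)) z)
      = 2 * (ynorm z * snd z $ i + (snd z \<bullet> snd z) * (snd z $ i * inverse (ynorm z)))"
    unfolding inner_vec_def
    by (simp add: sum.distrib sum_distrib_left sum_distrib_right distrib_left mult_ac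
        if_distrib[of "(*) _"] cong: if_cong)
  also have "(snd z \<bullet> snd z) * (snd z $ i * inverse (ynorm z)) = ynorm z * snd z $ i"
    using ex_slit_nonzero[OF z] by (simp add: dot_square_norm power2_eq_square)
  finally have "(\<Sum>r\<in>UNIV. snd z $ r * dx r (dy i (sq ex_f)) z) = 4 * (ynorm z * snd z $ i)"
    by simp
  moreover have "dx i (sq ex_f) z = 2 * (ynorm z * snd z $ i)"
    unfolding dx_ex_energy[OF z, symmetric] unfolding dx_eq_dirder
    by (rule dirder_cong[OF open_ex_slit z sq])
  ultimately show ?thesis
    unfolding Hcov_def metric_spray[OF z] euler_lagrange_def by simp
qed

lemma H_Landsberg_ex: "H_Landsberg {ex_chart} ex_F"
proof -
  interpret local_finsler ex_f ex_slit by (rule local_finsler_ex)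
  let ?T = "\<lambda>z. 1/6 * (ynorm z * (ynorm z * ynorm z)) :: real"
  have sm: "smooth_on ex_slit ?T" by (intro smooth_ex)
  have "homogeneous (1 + (1 + 1)) ex_slit ?T"
    by (intro homogeneous_cmult homogeneous_mult homogeneous_ynorm smooth_ex) auto
  then have hom: "homogeneous 3 ex_slit ?T" by simp
  have "Hcov ex_f i z = dy i ?T z" if z: "z \<in> ex_slit" for i z
  proof -
    have NN: "smooth_on ex_slit (\<lambda>z. ynorm z * ynorm z)" by (intro smooth_ex)
    have "dirder (0, axis i 1) ?T z = 1/6 * dirder (0, axis i 1) (\<lambda>z. ynorm z * (ynorm z * ynorm z)) z"
      by (intro dirder_cmult[OF _ z] smooth_ex)
    also have "\<dots> = 1/2 * (ynorm z * snd z $ i)"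
      unfolding dirder_mult[OF smooth_ynorm_ex NN z] dirder_mult[OF smooth_ynorm_ex smooth_ynorm_ex z] dirder_ynorm[OF ex_slit_nonzero[OF z]]
      using ex_slit_nonzero[OF z] by (simp add: inner_axis field_simps)
    finally show ?thesis by (simp add: Hcov_ex[OF z] dy_eq_dirder)
  qed
  from Lcov_zero_if_Hcov_gradient[OF sm hom this] show ?thesis
    by (simp add: H_Landsberg_def slit_coords_ex_chart)
qed

lemma not_H_Berwald_ex: "\<not> H_Berwald {ex_chart} ex_F"
proof -
  interpret local_finsler ex_f ex_slit by (rule local_finsler_ex)
  let ?u = "\<lambda>z :: (real ^ 2) \<times> (real ^ 2). snd z $ 1" and ?W = "\<lambda>z :: (real ^ 2) \<times> (real ^ 2). inverse (ynorm z)"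
  \<comment> \<open>The second derivative of \<open>H\<^sub>1\<close> is \<open>y\<^sub>1\<close> times \<open>?R\<close>.  Where \<open>y\<^sub>1 = 0\<close> the third derivative is therefore the value of \<open>?R\<close>.\<close>
  let ?R = "\<lambda>z. 1/2 * (3 * ?W z - ?u z * (?u z * (?W z * (?W z * ?W z))))"
  let ?D = "dirder (0, axis (1::2) 1) :: 2 field \<Rightarrow> 2 field"
  note sm = smooth_ex smooth_inverse_ynorm_ex smooth_on_diff[OF open_ex_slit]
  have W: "?D ?W z = - ?u z * (?W z * (?W z * ?W z))" and ynorm: "?D ynorm z = ?u z * ?W z"
    and u: "?D ?u z = 1" if "z \<in> ex_slit" for z
    using that by (simp_all add: dirder_ynorm dirder_inverse_ynorm dirder_y inner_axis power3_eq_cube ex_slit_nonzero)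
  have 1: "dy 1 (Hcov ex_f 1) z = 1/2 * (ynorm z + ?u z * (?u z * ?W z))" if z: "z \<in> ex_slit" for z
  proof -
    have "dy 1 (Hcov ex_f 1) z = ?D (\<lambda>z. 1/2 * (ynorm z * ?u z)) z"
      unfolding dy_eq_dirder by (rule dirder_cong[OF open_ex_slit z Hcov_ex])
    also have "\<dots> = 1/2 * ?D (\<lambda>z. ynorm z * ?u z) z" by (intro dirder_cmult[OF _ z] sm)
    finally show ?thesis unfolding dirder_mult[OF smooth_ynorm_ex smooth_y_ex z] ynorm[OF z] u[OF z] by simp
  qed
  have 2: "dy 1 (dy 1 (Hcov ex_f 1)) z = ?u z * ?R z" if z: "z \<in> ex_slit" for z
  proof -
    have uW: "smooth_on ex_slit (\<lambda>z. ?u z * ?W z)" by (intro sm)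
    have "dy 1 (dy 1 (Hcov ex_f 1)) z = ?D (\<lambda>z. 1/2 * (ynorm z + ?u z * (?u z * ?W z))) z"
      unfolding dy_eq_dirder by (rule dirder_cong[OF open_ex_slit z 1[unfolded dy_eq_dirder]])
    also have "\<dots> = 1/2 * ?D (\<lambda>z. ynorm z + ?u z * (?u z * ?W z)) z" by (intro dirder_cmult[OF _ z] sm)
    also have "?D (\<lambda>z. ynorm z + ?u z * (?u z * ?W z)) z = ?D ynorm z + ?D (\<lambda>z. ?u z * (?u z * ?W z)) z"
      by (intro dirder_add[OF _ _ z] sm)
    finally show ?thesis
      unfolding dirder_mult[OF smooth_y_ex uW z] dirder_mult[OF smooth_y_ex smooth_inverse_ynorm_ex z] ynorm[OF z] u[OF z] W[OF z]
      by (simp add: algebra_simps)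
  qed
  let ?z = "(0, axis 2 1) :: (real ^ 2) \<times> (real ^ 2)"
  have z: "?z \<in> ex_slit" by (simp add: ex_dom_def axis_eq_0_iff)
  have "Hcov3 ex_f 1 1 1 1 ?z = ?D (\<lambda>z. ?u z * ?R z) ?z"
    unfolding Hcov3_def Hcov2_def Hcov1_def dy_eq_dirder
    by (rule dirder_cong[OF open_ex_slit z 2[unfolded dy_eq_dirder]])
  also have "\<dots> = ?u ?z * ?D ?R ?z + ?D ?u ?z * ?R ?z"
    by (intro dirder_mult[OF _ _ z] sm)
  also have "\<dots> = 3/2"
    unfolding u[OF z] by (simp add: axis_def) (simp flip: axis_def)
  finally have "Hcov3 ex_f 1 1 1 1 ?z \<noteq> 0" by simp
  then show ?thesis
    using z unfolding H_Berwald_def slit_coords_ex_chart[symmetric] by blast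
qed

section \<open>The comparison theorem\<close>

theorem theorem3p15:
  shows "((\<forall>(M :: 'm topology) (\<A> :: ('m, 'n::finite) chart set) F.
            finsler_manifold M \<A> F \<and> H_Berwald \<A> F \<longrightarrow> H_Landsberg \<A> F) \<and>
          (\<exists>(M :: (real ^ 2) topology) (\<A> :: (real ^ 2, 2) chart set) F.
            finsler_manifold M \<A> F \<and> H_Landsberg \<A> F \<and> \<not> H_Berwald \<A> F)) \<and>
         (\<forall>(M :: 'm topology) (\<A> :: ('m, 'n::finite) chart set) F.
            finsler_manifold M \<A> F \<and> Berwald_condition \<A> F \<longrightarrow>
            (H_Berwald \<A> F \<longleftrightarrow> Berwald \<A> F)) \<and>
         (\<forall>(M :: 'm topology) (\<A> :: ('m, 'n::finite) chart set) F.
            finsler_manifold M \<A> F \<and> Landsberg_condition \<A> F \<longrightarrow>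
            (H_Landsberg \<A> F \<longleftrightarrow> Landsberg \<A> F))"
proof (intro conjI allI impI)
  fix M :: "'m topology" and \<A> :: "('m, 'n) chart set" and F
  assume "finsler_manifold M \<A> F \<and> H_Berwald \<A> F"
  then show "H_Landsberg \<A> F" using H_Berwald_imp_H_Landsberg by blast
next
  show "\<exists>(M :: (real ^ 2) topology) (\<A> :: (real ^ 2, 2) chart set) F.
      finsler_manifold M \<A> F \<and> H_Landsberg \<A> F \<and> \<not> H_Berwald \<A> F"
    using finsler_manifold_ex H_Landsberg_ex not_H_Berwald_ex by blast
next
  fix M :: "'m topology" and \<A> :: "('m, 'n) chart set" and F
  assume "finsler_manifold M \<A> F \<and> Berwald_condition \<A> F"
  then show "H_Berwald \<A> F \<longleftrightarrow> Berwald \<A> F" using H_Berwald_iff_Berwald by blast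
next
  fix M :: "'m topology" and \<A> :: "('m, 'n) chart set" and F
  assume "finsler_manifold M \<A> F \<and> Landsberg_condition \<A> F"
  then show "H_Landsberg \<A> F \<longleftrightarrow> Landsberg \<A> F" using H_Landsberg_iff_Landsberg by blast
qed

end
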